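(* Let $G$ be a type definable group in a theory $T$ of bounded dp-rank. Let $\{p_i(x,a_i)\mid i<\omega\}$ be a family of partial types, each $p_i(\mathfrak{C},a_i)$ being a (type definable) subgroup of $G$, such that $\langle a_i\mid i<\omega\rangle$ is an indiscernible sequence and $p_{2i}=p_{2i+1}$ for all $i<\omega$. Then there are some $n<\omega$ and $i<n$ such that $\bigcap_{j<n,\,j\ne i}p_j(\mathfrak{C},a_j)=\bigcap_{j<n}p_j(\mathfrak{C},a_j)$. In particular, if $p_i=p$ is constant and $\langle a_i\mid i<\omega\rangle$ is an indiscernible set, then for some $n<\omega$, $\bigcap_{i<\omega}p(\mathfrak{C},a_i)=\bigcap_{i<n}p(\mathfrak{C},a_i)$. In particular, $T$ has Property A: whenever $G$ is a type definable group, $p(x,y)$ is a type and $\langle a_i\mid i<\omega\rangle$ is an indiscernible sequence such that $G_i=p(\mathfrak{C},a_i)$ is a subgroup of $G$ for each $i<\omega$, there is some $n<\omega$ such that for every finite set $v\subseteq\omega$ there is $v'\subseteq v$ with $|v'|\le n$ and $\bigcap_{i\in v}G_i=\bigcap_{i\in v'}G_i$.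
   Context: $T$ is a complete first order theory and $\mathfrak{C}$ is its monster model (a very big saturated model containing all small models). The types $p_i(x,y)$, $p(x,y)$ are partial types without further parameters. An indiscernible set is a sequence that is indiscernible under every reordering (totally indiscernible). Type definable group: given by a partial type $\Sigma(x)$ ($x$ a finite tuple), possibly over a small set of parameters, and a formula $\nu(x,y,z)$ such that $\langle \Sigma(\mathfrak{C}),\nu\rangle$ is a group with $\nu$ defining the (graph of the) group operation. An empty intersection of subgroups of $G$ is $G$. Indiscernible array: $\langle a_{i,j}\mid i<n,\ j<\omega\rangle$ (tuples) is an indiscernible array over $A$ if for each $i_0<n$ the row $\langle a_{i_0,j}\mid j<\omega\rangle$ is indiscernible over $A\cup\{a_{i,j}\mid i\ne i_0,\ i<n,\ j<\omega\}$. Bounded dp-rank: $T$ has bounded dp-rank if there is some $n<\omega$ for which the following configuration does not exist: formulas $\langle\varphi_i(x,y_i)\mid i<n\rangle$ with $x$ a single variable, and an array $\langle a_{i,j}\mid i<n,\ j<\omega\rangle$ which is an indiscernible array over $\emptyset$, such that $\{\varphi_i(x,a_{i,0})\wedge\neg\varphi_i(x,a_{i,1})\mid i<n\}$ is consistent. *)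

theory Defs
  imports Main "HOL-Library.FuncSet" "HOL-Algebra.Group"
begin

unbundle cardinal_syntax

section \<open>First-order languages, formulas and structures\<close>

text \<open>The symbols of a language are subsets of the symbol types, so that a language may for instance
  have no function symbols at all.\<close>

record ('f, 'r) language =
  fun_syms :: "'f set"
  fun_arity :: "'f \<Rightarrow> nat"
  rel_syms :: "'r set"
  rel_arity :: "'r \<Rightarrow> nat"

datatype ('f, 'v) tm = Var 'v | Fn 'f "('f, 'v) tm list"

datatype ('f, 'r, 'v) fm =
    Eq "('f, 'v) tm" "('f, 'v) tm"
  | Rel 'r "('f, 'v) tm list"
  | Neg "('f, 'r, 'v) fm"
  | And "('f, 'r, 'v) fm" "('f, 'r, 'v) fm"
  | Ex 'v "('f, 'r, 'v) fm"

fun wf_tm :: "('f, 'r) language \<Rightarrow> ('f, 'v) tm \<Rightarrow> bool" where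
  "wf_tm L (Var v) \<longleftrightarrow> True"
| "wf_tm L (Fn f ts) \<longleftrightarrow>
     f \<in> fun_syms L \<and> length ts = fun_arity L f \<and> (\<forall>t \<in> set ts. wf_tm L t)"

primrec wf_fm :: "('f, 'r) language \<Rightarrow> ('f, 'r, 'v) fm \<Rightarrow> bool" where
  "wf_fm L (Eq s t) \<longleftrightarrow> wf_tm L s \<and> wf_tm L t"
| "wf_fm L (Rel r ts) \<longleftrightarrow>
     r \<in> rel_syms L \<and> length ts = rel_arity L r \<and> (\<forall>t \<in> set ts. wf_tm L t)"
| "wf_fm L (Neg \<phi>) \<longleftrightarrow> wf_fm L \<phi>"
| "wf_fm L (And \<phi> \<psi>) \<longleftrightarrow> wf_fm L \<phi> \<and> wf_fm L \<psi>"
| "wf_fm L (Ex v \<phi>) \<longleftrightarrow> wf_fm L \<phi>"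

fun fv_tm :: "('f, 'v) tm \<Rightarrow> 'v set" where
  "fv_tm (Var v) = {v}"
| "fv_tm (Fn f ts) = \<Union> (fv_tm ` set ts)"

primrec fv :: "('f, 'r, 'v) fm \<Rightarrow> 'v set" where
  "fv (Eq s t) = fv_tm s \<union> fv_tm t"
| "fv (Rel r ts) = \<Union> (fv_tm ` set ts)"
| "fv (Neg \<phi>) = fv \<phi>"
| "fv (And \<phi> \<psi>) = fv \<phi> \<union> fv \<psi>"
| "fv (Ex v \<phi>) = fv \<phi> - {v}"

definition formulas :: "('f, 'r) language \<Rightarrow> 'v set \<Rightarrow> ('f, 'r, 'v) fm set" where
  "formulas L V = {\<phi>. wf_fm L \<phi> \<and> fv \<phi> \<subseteq> V}"

record ('f, 'r, 'm) struct =
  univ :: "'m set"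
  fun_int :: "'f \<Rightarrow> 'm list \<Rightarrow> 'm"
  rel_int :: "'r \<Rightarrow> 'm list \<Rightarrow> bool"

definition is_struct :: "('f, 'r) language \<Rightarrow> ('f, 'r, 'm) struct \<Rightarrow> bool" where
  "is_struct L M \<longleftrightarrow> univ M \<noteq> {} \<and>
     (\<forall>f \<in> fun_syms L. \<forall>xs. set xs \<subseteq> univ M \<and> length xs = fun_arity L f \<longrightarrow> fun_int M f xs \<in> univ M)"

primrec eval :: "('f, 'r, 'm) struct \<Rightarrow> ('v \<Rightarrow> 'm) \<Rightarrow> ('f, 'v) tm \<Rightarrow> 'm" where
  "eval M e (Var v) = e v"
| "eval M e (Fn f ts) = fun_int M f (map (eval M e) ts)"

primrec sat :: "('f, 'r, 'm) struct \<Rightarrow> ('v \<Rightarrow> 'm) \<Rightarrow> ('f, 'r, 'v) fm \<Rightarrow> bool" where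
  "sat M e (Eq s t) \<longleftrightarrow> eval M e s = eval M e t"
| "sat M e (Rel r ts) \<longleftrightarrow> rel_int M r (map (eval M e) ts)"
| "sat M e (Neg \<phi>) \<longleftrightarrow> \<not> sat M e \<phi>"
| "sat M e (And \<phi> \<psi>) \<longleftrightarrow> sat M e \<phi> \<and> sat M e \<psi>"
| "sat M e (Ex v \<phi>) \<longleftrightarrow> (\<exists>x \<in> univ M. sat M (e(v := x)) \<phi>)"

section \<open>Complete theories\<close>

definition models :: "('f, 'r, 'm) struct \<Rightarrow> ('f, 'r, nat) fm set \<Rightarrow> bool" where
  "models M T \<longleftrightarrow> (\<forall>\<sigma> \<in> T. \<forall>e. range e \<subseteq> univ M \<longrightarrow> sat M e \<sigma>)"

text \<open>By the downward Loewenheim--Skolem theorem, it suffices to test entailment on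
  structures whose universe is a subset of \<^typ>\<open>'f + 'r + nat\<close>.\<close>

definition entails :: "('f, 'r) language \<Rightarrow> ('f, 'r, nat) fm set \<Rightarrow> ('f, 'r, nat) fm \<Rightarrow> bool" where
  "entails L T \<sigma> \<longleftrightarrow>
     (\<forall>M :: ('f, 'r, 'f + 'r + nat) struct. is_struct L M \<and> models M T \<longrightarrow> models M {\<sigma>})"

definition complete_theory :: "('f, 'r) language \<Rightarrow> ('f, 'r, nat) fm set \<Rightarrow> bool" where
  "complete_theory L T \<longleftrightarrow> T \<subseteq> formulas L {} \<and>
     (\<exists>M :: ('f, 'r, 'f + 'r + nat) struct. is_struct L M \<and> models M T) \<and>
     (\<forall>\<sigma> \<in> formulas L {}. entails L T \<sigma> \<or> entails L T (Neg \<sigma>))"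

section \<open>Types and monster models\<close>

definition tuples :: "('f, 'r, 'm) struct \<Rightarrow> 'i set \<Rightarrow> ('i \<Rightarrow> 'm) set" where
  "tuples M I = I \<rightarrow>\<^sub>E univ M"

text \<open>A partial type \<open>p(x, y)\<close> in tuples of variables \<open>x = (x\<^sub>i)\<^sub>i\<^sub>\<in>\<^sub>I\<close> and \<open>y = (y\<^sub>j)\<^sub>j\<^sub>\<in>\<^sub>J\<close>
  is a subset of \<^term>\<open>formulas L (I <+> J)\<close>: the variable \<open>x\<^sub>i\<close> is \<^term>\<open>Inl i\<close> and \<open>y\<^sub>j\<close> is
  \<^term>\<open>Inr j\<close>. Then \<open>realizations M I p a\<close> is \<open>p(M, a)\<close>.

  A partial type over a set \<open>A\<close> of parameters is treated as the case \<open>J = A\<close>, that is, an element of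
  \<open>A\<close> serves as a variable standing for itself; its set of realizations is
  \<open>realizations M I p id\<close>.\<close>

definition realizations ::
    "('f, 'r, 'm) struct \<Rightarrow> 'i set \<Rightarrow> ('f, 'r, 'i + 'j) fm set \<Rightarrow> ('j \<Rightarrow> 'm) \<Rightarrow> ('i \<Rightarrow> 'm) set" where
  "realizations M I p a = {c \<in> tuples M I. \<forall>\<phi> \<in> p. sat M (case_sum c a) \<phi>}"

definition saturated :: "('f, 'r) language \<Rightarrow> ('f, 'r, 'm) struct \<Rightarrow> bool" where
  "saturated L M \<longleftrightarrow>
     (\<forall>A p. A \<subseteq> univ M \<and> |A| <o |univ M| \<and> p \<subseteq> formulas L ({..<1::nat} <+> A) \<and>
        (\<forall>q. finite q \<and> q \<subseteq> p \<longrightarrow> realizations M {..<1} q id \<noteq> {})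
        \<longrightarrow> realizations M {..<1} p id \<noteq> {})"

definition elementary_embedding ::
    "('f, 'r) language \<Rightarrow> ('m \<Rightarrow> 'n) \<Rightarrow> ('f, 'r, 'm) struct \<Rightarrow> ('f, 'r, 'n) struct \<Rightarrow> bool" where
  "elementary_embedding L h N M \<longleftrightarrow> h ` univ N \<subseteq> univ M \<and>
     (\<forall>\<phi> \<in> formulas L (UNIV :: nat set). \<forall>e. range e \<subseteq> univ N \<longrightarrow>
        (sat N e \<phi> \<longleftrightarrow> sat M (h \<circ> e) \<phi>))"

text \<open>``Small'' means of cardinality less than that of the monster model. The monster model is larger
  than the number of formulas.\<close>

definition monster_model ::
    "('f, 'r) language \<Rightarrow> ('f, 'r, nat) fm set \<Rightarrow> ('f, 'r, 'm) struct \<Rightarrow> bool" where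
  "monster_model L T M \<longleftrightarrow> is_struct L M \<and> models M T \<and>
     natLeq <o |univ M| \<and> |fun_syms L| <o |univ M| \<and> |rel_syms L| <o |univ M| \<and>
     saturated L M \<and>
     (\<forall>N :: ('f, 'r, 'm) struct. is_struct L N \<and> models N T \<and> |univ N| <o |univ M|
        \<longrightarrow> (\<exists>h. elementary_embedding L h N M))"

section \<open>Type definable groups\<close>

text \<open>In formulas about several tuples indexed by \<open>J\<close>, the variable \<^term>\<open>Inl (t, j)\<close> is the \<open>j\<close>-th
  coordinate of the \<open>t\<close>-th tuple. As above, \<^term>\<open>Inr\<close> marks parameters.\<close>

definition type_definable_group ::
    "('f, 'r) language \<Rightarrow> ('f, 'r, 'm) struct \<Rightarrow> nat \<Rightarrow> (nat \<Rightarrow> 'm) monoid \<Rightarrow> bool" where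
  "type_definable_group L M k G \<longleftrightarrow>
     (\<exists>A \<Sigma> \<nu>. A \<subseteq> univ M \<and> |A| <o |univ M| \<and>
        \<Sigma> \<subseteq> formulas L ({..<k} <+> A) \<and>
        \<nu> \<in> formulas L (({..<3::nat} \<times> {..<k}) <+> A) \<and>
        group G \<and> carrier G = realizations M {..<k} \<Sigma> id \<and>
        (\<forall>u \<in> carrier G. \<forall>v \<in> carrier G. \<forall>w \<in> carrier G.
           sat M (case_sum (\<lambda>(t, i). ([u, v, w] ! t) i) id) \<nu> \<longleftrightarrow> u \<otimes>\<^bsub>G\<^esub> v = w))"

text \<open>Intersection of a family of subsets of a group, the empty intersection being the group.\<close>

definition inter_in :: "('g, 'b) monoid_scheme \<Rightarrow> 'i set \<Rightarrow> ('i \<Rightarrow> 'g set) \<Rightarrow> 'g set" where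
  "inter_in G I H = carrier G \<inter> (\<Inter>i \<in> I. H i)"

section \<open>Indiscernibility and dp-rank\<close>

definition indiscernible_over ::
    "('f, 'r) language \<Rightarrow> ('f, 'r, 'm) struct \<Rightarrow> 'm set \<Rightarrow> 'j set \<Rightarrow> (nat \<Rightarrow> 'j \<Rightarrow> 'm) \<Rightarrow> bool" where
  "indiscernible_over L M A J a \<longleftrightarrow> (\<forall>i. a i \<in> tuples M J) \<and>
     (\<forall>n :: nat. \<forall>\<phi> \<in> formulas L (({..<n} \<times> J) <+> A). \<forall>s s'.
        strict_mono_on {..<n} s \<and> strict_mono_on {..<n} s' \<longrightarrow>
        (sat M (case_sum (\<lambda>(t, j). a (s t) j) id) \<phi> \<longleftrightarrow>
         sat M (case_sum (\<lambda>(t, j). a (s' t) j) id) \<phi>))"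

abbreviation indiscernible_sequence ::
    "('f, 'r) language \<Rightarrow> ('f, 'r, 'm) struct \<Rightarrow> 'j set \<Rightarrow> (nat \<Rightarrow> 'j \<Rightarrow> 'm) \<Rightarrow> bool" where
  "indiscernible_sequence L M J a \<equiv> indiscernible_over L M {} J a"

definition indiscernible_set ::
    "('f, 'r) language \<Rightarrow> ('f, 'r, 'm) struct \<Rightarrow> 'j set \<Rightarrow> (nat \<Rightarrow> 'j \<Rightarrow> 'm) \<Rightarrow> bool" where
  "indiscernible_set L M J a \<longleftrightarrow> (\<forall>\<pi>. bij \<pi> \<longrightarrow> indiscernible_sequence L M J (a \<circ> \<pi>))"

text \<open>The tuples in row \<open>i\<close> of an array have coordinates indexed by \<open>J i\<close>.\<close>

definition indiscernible_array_over ::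
    "('f, 'r) language \<Rightarrow> ('f, 'r, 'm) struct \<Rightarrow> 'm set \<Rightarrow> nat \<Rightarrow> (nat \<Rightarrow> 'j set) \<Rightarrow>
     (nat \<Rightarrow> nat \<Rightarrow> 'j \<Rightarrow> 'm) \<Rightarrow> bool" where
  "indiscernible_array_over L M A n J a \<longleftrightarrow>
     (\<forall>i\<^sub>0 < n. indiscernible_over L M (A \<union> (\<Union>i \<in> {..<n} - {i\<^sub>0}. \<Union>j. a i j ` J i)) (J i\<^sub>0) (a i\<^sub>0))"

text \<open>Boundedness of the dp-rank of the theory of \<open>M\<close>, where \<open>M\<close> is a monster model; consistency of
  a finite set of formulas over \<open>M\<close> is realization in \<open>M\<close>.\<close>

definition bounded_dp_rank :: "('f, 'r) language \<Rightarrow> ('f, 'r, 'm) struct \<Rightarrow> bool" where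
  "bounded_dp_rank L M \<longleftrightarrow>
     (\<exists>n. \<not> (\<exists>(m :: nat \<Rightarrow> nat) (\<phi> :: nat \<Rightarrow> ('f, 'r, nat + nat) fm) a.
        (\<forall>i<n. \<phi> i \<in> formulas L ({..<1} <+> {..<m i})) \<and>
        indiscernible_array_over L M {} n (\<lambda>i. {..<m i}) a \<and>
        (\<exists>c \<in> tuples M {..<1}. \<forall>i<n.
           sat M (case_sum c (a i 0)) (\<phi> i) \<and> \<not> sat M (case_sum c (a i 1)) (\<phi> i))))"

section \<open>Property A\<close>

text \<open>The argument of type \<^typ>\<open>'j itself\<close> only fixes the type from which the coordinates of the
  (possibly infinite, but small) tuple \<open>y\<close> are drawn.\<close>

definition property_A :: "'j itself \<Rightarrow> ('f, 'r) language \<Rightarrow> ('f, 'r, 'm) struct \<Rightarrow> bool" where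
  "property_A _ L M \<longleftrightarrow>
     (\<forall>k G (J :: 'j set) p a.
        type_definable_group L M k G \<and>
        |J| <o |univ M| \<and> p \<subseteq> formulas L ({..<k} <+> J) \<and>
        indiscernible_sequence L M J a \<and>
        (\<forall>i. subgroup (realizations M {..<k} p (a i)) G) \<longrightarrow>
        (\<exists>n. \<forall>v. finite v \<longrightarrow> (\<exists>v' \<subseteq> v. card v' \<le> n \<and>
           inter_in G v (\<lambda>i. realizations M {..<k} p (a i)) =
           inter_in G v' (\<lambda>i. realizations M {..<k} p (a i)))))"

end

theory Submission
  imports Defs "HOL-Library.Ramsey" "HOL-Library.Countable"
begin

text \<open>Let \<open>H i = p\<^sub>i(M, a\<^sub>i)\<close>, and suppose that none of the first \<open>n\<close> subgroups is redundant in
  their intersection, for any \<open>n\<close>. Given \<open>N\<close>, multiply, for all \<open>i < N\<close>, elements that lie in all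
  of the first \<open>2 N\<close> subgroups except \<open>H (2 i + 1)\<close>. The product lies in \<open>H (2 i)\<close> but not in
  \<open>H (2 i + 1)\<close>, for all \<open>i < N\<close> (\<open>separating_element\<close>). As \<open>p\<^sub>2\<^sub>i = p\<^sub>2\<^sub>i\<^sub>+\<^sub>1\<close>, some formula
  \<open>\<phi>\<^sub>i\<close> in this type is true of the product and \<open>a\<^sub>2\<^sub>i\<close> but false of the product and \<open>a\<^sub>2\<^sub>i\<^sub>+\<^sub>1\<close>.
  By indiscernibility, there is such an element for every increasing choice of \<open>2 N\<close> indices; this
  is called a pattern with \<open>N\<close> rows in \<open>k\<close> variables, \<open>k\<close> being the length of the tuples in the
  group. Ramsey's theorem and compactness turn it into a pattern on an indiscernible array
  (\<open>extract_indiscernible_array\<close>). So it contradicts bounded dp-rank if \<open>k = 1\<close>.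

  For larger \<open>k\<close>, bounded dp-rank has to be extended from single variables to tuples. A coarse
  bound suffices: if \<open>n\<close> rows are impossible in one variable, then \<open>n\<^sup>k\<close> rows are impossible in
  \<open>k\<close> variables. Indeed, group \<open>n m\<close> rows in \<open>k + 1\<close> variables into \<open>n\<close> blocks and consider the
  last coordinate \<open>d\<close> of a realization. Either, in one of the blocks, the other coordinates can be
  found for the same \<open>d\<close> and all later choices of columns in the array; then this block is a
  pattern with \<open>m\<close> rows in \<open>k\<close> variables, with \<open>d\<close> as a parameter. Or this fails in every block,
  for some later columns; then the \<open>n\<close> blocks form the rows of a pattern for the single variable
  \<open>d\<close> (\<open>dp_pattern_drop_variable\<close>).

  If \<open>p\<^sub>i = p\<close> is constant, then the redundancy of one of the first \<open>n\<close> subgroups carries over to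
  all \<open>n\<close>-tuples of indices of the same type, by compactness (\<open>intersection_subset_transfer\<close>). In
  an indiscernible sequence, these are the increasing tuples, which gives Property A by removing
  redundant indices one after the other. In an indiscernible set, these are all tuples of distinct
  indices, so the intersection of the first \<open>n - 1\<close> subgroups is contained in all others.\<close>

section \<open>Renaming variables\<close>

lemma finite_fv_tm: "finite (fv_tm t)"
  by (induction t) auto

lemma finite_fv: "finite (fv \<phi>)"
  by (induction \<phi>) (auto simp: finite_fv_tm)

lemma eval_cong: "(\<And>v. v \<in> fv_tm t \<Longrightarrow> e v = e' v) \<Longrightarrow> eval M e t = eval M e' t"
proof (induction t)
  case (Fn f ts)
  then have "map (eval M e) ts = map (eval M e') ts"
    by auto
  then show ?case
    by (simp only: eval.simps)
qed simp

lemma sat_cong: "(\<And>v. v \<in> fv \<phi> \<Longrightarrow> e v = e' v) \<Longrightarrow> sat M e \<phi> \<longleftrightarrow> sat M e' \<phi>"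
proof (induction \<phi> arbitrary: e e')
  case (Eq s t)
  then show ?case
    using eval_cong[of s e e' M] eval_cong[of t e e' M] by simp
next
  case (Rel r ts)
  then have "map (eval M e) ts = map (eval M e') ts"
    by (auto intro!: eval_cong)
  then show ?case
    by (simp only: sat.simps)
next
  case (Neg \<phi>)
  then have "sat M e \<phi> \<longleftrightarrow> sat M e' \<phi>"
    by (intro Neg.IH) simp
  then show ?case
    by simp
next
  case (And \<phi> \<psi>)
  have "sat M e \<phi> \<longleftrightarrow> sat M e' \<phi>" "sat M e \<psi> \<longleftrightarrow> sat M e' \<psi>"
    using And.prems by (auto intro!: And.IH)
  then show ?case
    by simp
next
  case (Ex v \<phi>)
  have "sat M (e(v := x)) \<phi> \<longleftrightarrow> sat M (e'(v := x)) \<phi>" for x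
    using Ex.prems by (intro Ex.IH) auto
  then show ?case
    by simp
qed

lemma rename_tm:
  fixes t :: "('f, 'v) tm"
  shows "\<exists>u. (wf_tm L t \<longrightarrow> wf_tm L u) \<and> fv_tm u = f ` fv_tm t \<and>
    (\<forall>(M :: ('f, 'r, 'm) struct) e. eval M e u = eval M (e \<circ> f) t)"
proof (induction t)
  case (Var v)
  show ?case
    by (rule exI[of _ "Var (f v)"]) simp
next
  case (Fn g ts)
  then have "\<forall>t \<in> set ts. \<exists>u. (wf_tm L t \<longrightarrow> wf_tm L u) \<and> fv_tm u = f ` fv_tm t \<and>
      (\<forall>(M :: ('f, 'r, 'm) struct) e. eval M e u = eval M (e \<circ> f) t)"
    by (intro ballI Fn.IH)
  from bchoice[OF this] obtain u where u: "\<forall>t \<in> set ts. (wf_tm L t \<longrightarrow> wf_tm L (u t)) \<and>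
      fv_tm (u t) = f ` fv_tm t \<and> (\<forall>(M :: ('f, 'r, 'm) struct) e. eval M e (u t) = eval M (e \<circ> f) t)"
    ..
  then have "map (eval M e) (map u ts) = map (eval M (e \<circ> f)) ts"
    for M :: "('f, 'r, 'm) struct" and e
    by simp
  then have "eval M e (Fn g (map u ts)) = eval M (e \<circ> f) (Fn g ts)"
    for M :: "('f, 'r, 'm) struct" and e
    by (simp only: eval.simps)
  with u show ?case
    by (intro exI[of _ "Fn g (map u ts)"]) (auto simp: image_UN comp_def simp del: eval.simps)
qed

text \<open>A bound variable has to be renamed apart from the images of the free ones, which needs an
  infinite supply of new variables.\<close>

lemma rename_fm:
  fixes \<phi> :: "('f, 'r, 'v) fm" and f :: "'v \<Rightarrow> 'w"
  assumes inf: "infinite (UNIV :: 'w set)"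
  shows "\<exists>\<psi>. (wf_fm L \<phi> \<longrightarrow> wf_fm L \<psi>) \<and> fv \<psi> \<subseteq> f ` fv \<phi> \<and>
    (\<forall>(M :: ('f, 'r, 'm) struct) e. sat M e \<psi> \<longleftrightarrow> sat M (e \<circ> f) \<phi>)"
proof (induction \<phi> arbitrary: f)
  case (Eq s t)
  obtain s' t' where "wf_tm L s \<longrightarrow> wf_tm L s'" "fv_tm s' = f ` fv_tm s"
      "\<forall>(M :: ('f, 'r, 'm) struct) e. eval M e s' = eval M (e \<circ> f) s"
      "wf_tm L t \<longrightarrow> wf_tm L t'" "fv_tm t' = f ` fv_tm t"
      "\<forall>(M :: ('f, 'r, 'm) struct) e. eval M e t' = eval M (e \<circ> f) t"
    using rename_tm[of L s f] rename_tm[of L t f] by metis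
  then show ?case
    by (intro exI[of _ "Eq s' t'"]) (auto simp: comp_def)
next
  case (Rel r ts)
  obtain u where u: "\<And>t. (wf_tm L t \<longrightarrow> wf_tm L (u t)) \<and> fv_tm (u t) = f ` fv_tm t \<and>
      (\<forall>(M :: ('f, 'r, 'm) struct) e. eval M e (u t) = eval M (e \<circ> f) t)"
    using rename_tm[of L _ f] by metis
  then have "map (eval M e) (map u ts) = map (eval M (e \<circ> f)) ts" for M :: "('f, 'r, 'm) struct" and e
    by simp
  then have "sat M e (Rel r (map u ts)) = sat M (e \<circ> f) (Rel r ts)" for M :: "('f, 'r, 'm) struct" and e
    by (simp only: sat.simps)
  with u show ?case
    by (intro exI[of _ "Rel r (map u ts)"]) (auto simp: image_UN comp_def simp del: sat.simps)
next
  case (Neg \<phi>)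
  obtain \<psi> where "wf_fm L \<phi> \<longrightarrow> wf_fm L \<psi>" "fv \<psi> \<subseteq> f ` fv \<phi>"
      "\<forall>(M :: ('f, 'r, 'm) struct) e. sat M e \<psi> \<longleftrightarrow> sat M (e \<circ> f) \<phi>"
    using Neg[of f] by blast
  then show ?case
    by (intro exI[of _ "Neg \<psi>"]) (auto simp: comp_def)
next
  case (And \<phi>1 \<phi>2)
  obtain \<psi>1 \<psi>2 where "wf_fm L \<phi>1 \<longrightarrow> wf_fm L \<psi>1" "fv \<psi>1 \<subseteq> f ` fv \<phi>1"
      "\<forall>(M :: ('f, 'r, 'm) struct) e. sat M e \<psi>1 \<longleftrightarrow> sat M (e \<circ> f) \<phi>1"
      "wf_fm L \<phi>2 \<longrightarrow> wf_fm L \<psi>2" "fv \<psi>2 \<subseteq> f ` fv \<phi>2"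
      "\<forall>(M :: ('f, 'r, 'm) struct) e. sat M e \<psi>2 \<longleftrightarrow> sat M (e \<circ> f) \<phi>2"
    using And(1)[of f] And(2)[of f] by blast
  then show ?case
    by (intro exI[of _ "And \<psi>1 \<psi>2"]) (auto simp: comp_def)
next
  case (Ex v \<phi>)
  have "finite (f ` (fv \<phi> - {v}))"
    by (simp add: finite_fv)
  then obtain w where w: "w \<notin> f ` (fv \<phi> - {v})"
    using inf ex_new_if_finite by blast
  obtain \<psi> where \<psi>: "wf_fm L \<phi> \<longrightarrow> wf_fm L \<psi>" "fv \<psi> \<subseteq> (f(v := w)) ` fv \<phi>"
      "\<forall>(M :: ('f, 'r, 'm) struct) e. sat M e \<psi> \<longleftrightarrow> sat M (e \<circ> f(v := w)) \<phi>"
    using Ex[of "f(v := w)"] by blast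
  have "sat M (e(w := x) \<circ> f(v := w)) \<phi> \<longleftrightarrow> sat M ((e \<circ> f)(v := x)) \<phi>"
    for M :: "('f, 'r, 'm) struct" and e x
    using w by (intro sat_cong) auto
  then have "sat M e (Ex w \<psi>) \<longleftrightarrow> sat M (e \<circ> f) (Ex v \<phi>)" for M :: "('f, 'r, 'm) struct" and e
    by (simp only: sat.simps \<psi>(3))
  with \<psi>(1,2) show ?case
    by (intro exI[of _ "Ex w \<psi>"]) (auto simp: comp_def simp del: sat.simps)
qed

section \<open>Definable predicates\<close>

text \<open>The interplay of formulas in many different sets of variables is easier to handle on the
  level of the predicates of assignments that they define. The set \<open>V\<close> contains the free
  variables; only assignments that map \<open>V\<close> into the structure matter.\<close>

definition definable ::
    "('f, 'r) language \<Rightarrow> ('f, 'r, 'm) struct \<Rightarrow> 'v set \<Rightarrow> (('v \<Rightarrow> 'm) \<Rightarrow> bool) \<Rightarrow> bool" where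
  "definable L M V D \<longleftrightarrow>
     (\<exists>\<phi> \<in> formulas L V. \<forall>e. (\<forall>v \<in> V. e v \<in> univ M) \<longrightarrow> (D e \<longleftrightarrow> sat M e \<phi>))"

lemma definable_sat: "\<phi> \<in> formulas L V \<Longrightarrow> definable L M V (\<lambda>e. sat M e \<phi>)"
  by (auto simp: definable_def)

lemma definable_mono:
  assumes "definable L M V D" "V \<subseteq> W"
  shows "definable L M W D"
proof -
  obtain \<phi> where \<phi>: "\<phi> \<in> formulas L V" "\<forall>e. (\<forall>v \<in> V. e v \<in> univ M) \<longrightarrow> (D e \<longleftrightarrow> sat M e \<phi>)"
    using assms(1) by (auto simp: definable_def)
  moreover have "\<phi> \<in> formulas L W"
    using \<phi>(1) assms(2) by (auto simp: formulas_def)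
  ultimately show ?thesis
    unfolding definable_def using assms(2) by (intro bexI[of _ \<phi>]) blast+
qed

lemma definable_cong:
  assumes "definable L M V D" "\<And>e. (\<forall>v \<in> V. e v \<in> univ M) \<Longrightarrow> D e \<longleftrightarrow> D' e"
  shows "definable L M V D'"
proof -
  obtain \<phi> where "\<phi> \<in> formulas L V" "\<forall>e. (\<forall>v \<in> V. e v \<in> univ M) \<longrightarrow> (D e \<longleftrightarrow> sat M e \<phi>)"
    using assms(1) by (auto simp: definable_def)
  then show ?thesis
    unfolding definable_def by (intro bexI[of _ \<phi>]) (simp_all add: assms(2)[symmetric])
qed

lemma definable_support:
  assumes "definable L M V D"
  shows "\<exists>F. finite F \<and> (\<forall>e e'. (\<forall>v \<in> V. e v \<in> univ M) \<and> (\<forall>v \<in> V. e' v \<in> univ M) \<and>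
    (\<forall>v \<in> F. e v = e' v) \<longrightarrow> (D e \<longleftrightarrow> D e'))"
proof -
  obtain \<phi> where "\<phi> \<in> formulas L V" "\<forall>e. (\<forall>v \<in> V. e v \<in> univ M) \<longrightarrow> (D e \<longleftrightarrow> sat M e \<phi>)"
    using assms by (auto simp: definable_def)
  moreover have "sat M e \<phi> \<longleftrightarrow> sat M e' \<phi>" if "\<forall>v \<in> fv \<phi>. e v = e' v" for e e'
    using that by (intro sat_cong) simp
  ultimately show ?thesis
    by (intro exI[of _ "fv \<phi>"]) (auto simp: finite_fv)
qed

lemma definable_agree:
  assumes "definable L M V D" "\<forall>v \<in> V. e v \<in> univ M" "\<And>v. v \<in> V \<Longrightarrow> e v = e' v"
  shows "D e \<longleftrightarrow> D e'"
proof -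
  obtain \<phi> where \<phi>: "\<phi> \<in> formulas L V" "\<And>e. (\<forall>v \<in> V. e v \<in> univ M) \<Longrightarrow> D e \<longleftrightarrow> sat M e \<phi>"
    using assms(1) by (auto simp: definable_def)
  have "sat M e \<phi> \<longleftrightarrow> sat M e' \<phi>"
    using \<phi>(1) assms(3) by (intro sat_cong) (auto simp: formulas_def)
  moreover have "\<forall>v \<in> V. e' v \<in> univ M"
    using assms(2,3) by simp
  ultimately show ?thesis
    using \<phi>(2) assms(2) by simp
qed

lemma definable_not:
  assumes "definable L M V D"
  shows "definable L M V (\<lambda>e. \<not> D e)"
proof -
  obtain \<phi> where "\<phi> \<in> formulas L V" "\<forall>e. (\<forall>v \<in> V. e v \<in> univ M) \<longrightarrow> (D e \<longleftrightarrow> sat M e \<phi>)"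
    using assms by (auto simp: definable_def)
  then show ?thesis
    unfolding definable_def by (intro bexI[of _ "Neg \<phi>"]) (auto simp: formulas_def)
qed

lemma definable_and:
  assumes "definable L M V D" "definable L M V E"
  shows "definable L M V (\<lambda>e. D e \<and> E e)"
proof -
  obtain \<phi> \<psi> where "\<phi> \<in> formulas L V" "\<forall>e. (\<forall>v \<in> V. e v \<in> univ M) \<longrightarrow> (D e \<longleftrightarrow> sat M e \<phi>)"
    "\<psi> \<in> formulas L V" "\<forall>e. (\<forall>v \<in> V. e v \<in> univ M) \<longrightarrow> (E e \<longleftrightarrow> sat M e \<psi>)"
    using assms by (auto simp: definable_def)
  then show ?thesis
    unfolding definable_def by (intro bexI[of _ "And \<phi> \<psi>"]) (auto simp: formulas_def)
qed

lemma definable_iff: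
  assumes "definable L M V D" "definable L M V E"
  shows "definable L M V (\<lambda>e. D e \<longleftrightarrow> E e)"
proof -
  have "definable L M V (\<lambda>e. \<not> (D e \<and> \<not> E e) \<and> \<not> (E e \<and> \<not> D e))"
    by (intro definable_and definable_not assms)
  moreover have "\<not> (D e \<and> \<not> E e) \<and> \<not> (E e \<and> \<not> D e) \<longleftrightarrow> (D e \<longleftrightarrow> E e)" for e
    by argo
  ultimately show ?thesis
    by simp
qed

lemma definable_ex:
  assumes "definable L M (insert v V) D"
  shows "definable L M V (\<lambda>e. \<exists>x \<in> univ M. D (e(v := x)))"
proof -
  obtain \<phi> where \<phi>: "\<phi> \<in> formulas L (insert v V)"
    "\<forall>e. (\<forall>w \<in> insert v V. e w \<in> univ M) \<longrightarrow> (D e \<longleftrightarrow> sat M e \<phi>)"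
    using assms by (auto simp: definable_def)
  have "D (e(v := x)) \<longleftrightarrow> sat M (e(v := x)) \<phi>" if "\<forall>w \<in> V. e w \<in> univ M" "x \<in> univ M" for e x
    using \<phi>(2) that by simp
  then show ?thesis
    using \<phi>(1) unfolding definable_def by (intro bexI[of _ "Ex v \<phi>"]) (auto simp: formulas_def)
qed

lemma definable_true:
  fixes M :: "('f, 'r, 'm) struct" and V :: "'v set"
  shows "definable L M V (\<lambda>_. True)"
proof -
  \<comment> \<open>Without a constant symbol, an atomic formula has a variable, which must be bound.\<close>
  have "Neg (Ex v (Neg (Eq (Var v) (Var v)))) \<in> formulas L V" for v
    by (auto simp: formulas_def)
  then show ?thesis
    unfolding definable_def by (rule bexI[rotated]) simp
qed

lemma definable_ball:
  assumes "finite I" "\<And>i. i \<in> I \<Longrightarrow> definable L M V (D i)"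
  shows "definable L M V (\<lambda>e. \<forall>i \<in> I. D i e)"
  using assms
proof (induction I rule: finite_induct)
  case empty
  then show ?case
    by (simp add: definable_true)
next
  case (insert i I)
  then have "definable L M V (\<lambda>e. D i e \<and> (\<forall>i \<in> I. D i e))"
    by (intro definable_and) auto
  then show ?case
    by simp
qed

lemma definable_rename:
  fixes f :: "'v \<Rightarrow> 'w"
  assumes "infinite (UNIV :: 'w set)" "definable L M V D" "f ` V \<subseteq> W"
  shows "definable L M W (\<lambda>e. D (e \<circ> f))"
proof -
  obtain \<phi> where \<phi>: "\<phi> \<in> formulas L V" "\<forall>e. (\<forall>v \<in> V. e v \<in> univ M) \<longrightarrow> (D e \<longleftrightarrow> sat M e \<phi>)"
    using assms by (auto simp: definable_def)
  obtain \<psi> where \<psi>: "wf_fm L \<phi> \<longrightarrow> wf_fm L \<psi>" "fv \<psi> \<subseteq> f ` fv \<phi>"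
      "\<forall>e. sat M e \<psi> \<longleftrightarrow> sat M (e \<circ> f) \<phi>"
    using rename_fm[OF assms(1), of L \<phi> f] by blast
  have "\<psi> \<in> formulas L W"
    using \<phi>(1) \<psi>(1,2) assms(3) by (auto simp: formulas_def)
  moreover have "D (e \<circ> f) \<longleftrightarrow> sat M e \<psi>" if "\<forall>w \<in> W. e w \<in> univ M" for e
    using \<phi>(2) \<psi>(3) assms(3) that by (auto simp: image_subset_iff)
  ultimately show ?thesis
    unfolding definable_def by blast
qed

lemma definable_ex_finite:
  assumes "finite F" "definable L M (F \<union> V) D"
  shows "definable L M V (\<lambda>e. \<exists>e'. (\<forall>v \<in> F. e' v \<in> univ M) \<and> (\<forall>v. v \<notin> F \<longrightarrow> e' v = e v) \<and> D e')"
  using assms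
proof (induction F arbitrary: V rule: finite_induct)
  case empty
  have "(\<forall>v. e' v = e v) \<longleftrightarrow> e' = e" for e e' :: "'a \<Rightarrow> 'd"
    by auto
  with empty show ?case
    by simp
next
  case (insert w F)
  let ?E = "\<lambda>e. \<exists>e'. (\<forall>v \<in> F. e' v \<in> univ M) \<and> (\<forall>v. v \<notin> F \<longrightarrow> e' v = e v) \<and> D e'"
  have "definable L M (insert w V) ?E"
    using insert.prems by (intro insert.IH) simp
  then have "definable L M V (\<lambda>e. \<exists>x \<in> univ M. ?E (e(w := x)))"
    by (rule definable_ex)
  moreover have "(\<exists>x \<in> univ M. ?E (e(w := x))) \<longleftrightarrow>
      (\<exists>e'. (\<forall>v \<in> insert w F. e' v \<in> univ M) \<and> (\<forall>v. v \<notin> insert w F \<longrightarrow> e' v = e v) \<and> D e')"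
    (is "?A \<longleftrightarrow> ?B") for e
  proof
    assume ?B
    then obtain e' where "\<forall>v \<in> insert w F. e' v \<in> univ M" "\<forall>v. v \<notin> insert w F \<longrightarrow> e' v = e v" "D e'"
      by blast
    then show ?A
      by (intro bexI[of _ "e' w"] exI[of _ e']) auto
  next
    assume ?A
    then obtain x e' where "x \<in> univ M" "\<forall>v \<in> F. e' v \<in> univ M"
        "\<forall>v. v \<notin> F \<longrightarrow> e' v = (e(w := x)) v" "D e'"
      by blast
    with insert.hyps(2) show ?B
      by (intro exI[of _ e']) auto
  qed
  ultimately show ?case
    by simp
qed

text \<open>Although \<open>W\<close> may be infinite, only finitely many of its variables occur in a formula.\<close>

lemma definable_ex_many:
  assumes "univ M \<noteq> {}" "definable L M (W \<union> V) D" "W \<inter> V = {}"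
  shows "definable L M V (\<lambda>e. \<exists>e'. (\<forall>v \<in> W. e' v \<in> univ M) \<and> (\<forall>v \<in> V. e' v = e v) \<and> D e')"
proof -
  obtain \<phi> where \<phi>: "\<phi> \<in> formulas L (W \<union> V)"
      "\<And>e. (\<forall>v \<in> W \<union> V. e v \<in> univ M) \<Longrightarrow> D e \<longleftrightarrow> sat M e \<phi>"
    using assms(2) by (auto simp: definable_def)
  define F where "F = fv \<phi> \<inter> W"
  obtain u where u: "u \<in> univ M"
    using assms(1) by blast
  have fv: "fv \<phi> \<subseteq> F \<union> V"
    using \<phi>(1) by (auto simp: formulas_def F_def)
  have "definable L M V (\<lambda>e. \<exists>e'. (\<forall>v \<in> F. e' v \<in> univ M) \<and> (\<forall>v. v \<notin> F \<longrightarrow> e' v = e v) \<and> sat M e' \<phi>)"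
    using \<phi>(1) fv by (intro definable_ex_finite definable_sat) (auto simp: formulas_def F_def finite_fv)
  moreover have "(\<exists>e'. (\<forall>v \<in> F. e' v \<in> univ M) \<and> (\<forall>v. v \<notin> F \<longrightarrow> e' v = e v) \<and> sat M e' \<phi>) \<longleftrightarrow>
      (\<exists>e'. (\<forall>v \<in> W. e' v \<in> univ M) \<and> (\<forall>v \<in> V. e' v = e v) \<and> D e')"
    (is "?A \<longleftrightarrow> ?B") if e: "\<forall>v \<in> V. e v \<in> univ M" for e
  proof
    assume ?A
    then obtain e' where e': "\<forall>v \<in> F. e' v \<in> univ M" "\<forall>v. v \<notin> F \<longrightarrow> e' v = e v" "sat M e' \<phi>"
      by blast
    have 1: "v \<notin> F" if "v \<in> V" for v
      using that assms(3) by (auto simp: F_def)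
    define e'' where "e'' = (\<lambda>v. if v \<in> F \<union> V then e' v else u)"
    have "sat M e'' \<phi> \<longleftrightarrow> sat M e' \<phi>"
      using fv by (intro sat_cong) (auto simp: e''_def)
    with e'(3) have "D e''"
      using \<phi>(2)[of e''] e e' u by (auto simp: e''_def 1)
    then show ?B
      using e e' u by (intro exI[of _ e'']) (auto simp: e''_def 1)
  next
    assume ?B
    then obtain e' where e': "\<forall>v \<in> W. e' v \<in> univ M" "\<forall>v \<in> V. e' v = e v" "D e'"
      by blast
    then have "\<forall>v \<in> W \<union> V. e' v \<in> univ M"
      using e by auto
    from \<phi>(2)[OF this] e'(3) have "sat M e' \<phi>"
      by simp
    define e'' where "e'' = (\<lambda>v. if v \<in> F then e' v else e v)"
    have "sat M e'' \<phi> \<longleftrightarrow> sat M e' \<phi>"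
      using fv e'(2) by (intro sat_cong) (auto simp: e''_def)
    with \<open>sat M e' \<phi>\<close> show ?A
      using e' by (intro exI[of _ e'']) (auto simp: e''_def F_def)
  qed
  ultimately show ?thesis
    by (rule definable_cong)
qed

text \<open>The form in which quantifiers over tuples are used below: the variables are split into
  those that are quantified and those that stay free.\<close>

lemma definable_ex_left:
  fixes K :: "'v set" and V :: "'w set"
  assumes M: "univ M \<noteq> {}" and inf: "infinite (UNIV :: 'w set)" and D: "definable L M (K <+> V) D"
  shows "definable L M V (\<lambda>e. \<exists>c \<in> K \<rightarrow> univ M. D (case_sum c e))"
proof -
  let ?E = "\<lambda>e. \<exists>e'. (\<forall>v \<in> Inl ` K. e' v \<in> univ M) \<and> (\<forall>v \<in> Inr ` V. e' v = e v) \<and> D e'"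
  define f :: "'v + 'w \<Rightarrow> 'w" where "f = case_sum (\<lambda>_. undefined) id"
  have "definable L M (Inl ` K \<union> Inr ` V) D"
    using D by (simp add: Plus_def)
  then have "definable L M (Inr ` V) ?E"
    by (rule definable_ex_many[OF M]) auto
  then have "definable L M V (\<lambda>e. ?E (e \<circ> f))"
    by (rule definable_rename[OF inf]) (simp add: f_def image_image)
  moreover have "?E (e \<circ> f) \<longleftrightarrow> (\<exists>c \<in> K \<rightarrow> univ M. D (case_sum c e))" if e: "\<forall>v \<in> V. e v \<in> univ M" for e
  proof
    assume "?E (e \<circ> f)"
    then obtain e' where e': "\<forall>v \<in> Inl ` K. e' v \<in> univ M" "\<forall>v \<in> Inr ` V. e' v = (e \<circ> f) v" "D e'"
      by blast
    have "D (case_sum (e' \<circ> Inl) e) \<longleftrightarrow> D e'"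
      using e e'(1,2) by (intro definable_agree[OF D]) (auto simp: f_def)
    with e'(1,3) show "\<exists>c \<in> K \<rightarrow> univ M. D (case_sum c e)"
      by (intro bexI[of _ "e' \<circ> Inl"]) auto
  next
    assume "\<exists>c \<in> K \<rightarrow> univ M. D (case_sum c e)"
    then obtain c where "c \<in> K \<rightarrow> univ M" "D (case_sum c e)"
      by blast
    then show "?E (e \<circ> f)"
      by (intro exI[of _ "case_sum c e"]) (auto simp: f_def)
  qed
  ultimately show ?thesis
    by (rule definable_cong)
qed

section \<open>Saturation and compactness\<close>

locale saturated_structure =
  fixes L :: "('f, 'r) language" and M :: "('f, 'r, 'm) struct"
  assumes saturated: "saturated L M" and infinite_univ: "infinite (univ M)"
begin

lemma univ_nonempty: "univ M \<noteq> {}"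
  using infinite_univ by auto

lemma saturation:
  fixes \<P> :: "((nat + 'm \<Rightarrow> 'm) \<Rightarrow> bool) set"
  assumes A: "A \<subseteq> univ M" "|A| <o |univ M|"
    and def: "\<And>D. D \<in> \<P> \<Longrightarrow> definable L M ({..<1} <+> A) D"
    and fin: "\<And>\<Q>. \<lbrakk>finite \<Q>; \<Q> \<subseteq> \<P>\<rbrakk> \<Longrightarrow> \<exists>x \<in> univ M. \<forall>D \<in> \<Q>. D (case_sum (\<lambda>_. x) id)"
  shows "\<exists>x \<in> univ M. \<forall>D \<in> \<P>. D (case_sum (\<lambda>_. x) id)"
proof -
  have "\<forall>D \<in> \<P>. \<exists>\<phi>. \<phi> \<in> formulas L ({..<1} <+> A) \<and>
      (\<forall>e. (\<forall>v \<in> {..<1} <+> A. e v \<in> univ M) \<longrightarrow> (D e \<longleftrightarrow> sat M e \<phi>))"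
    using def unfolding definable_def by blast
  then obtain \<phi> where \<phi>: "\<And>D. D \<in> \<P> \<Longrightarrow> \<phi> D \<in> formulas L ({..<1} <+> A)"
      "\<And>D e. D \<in> \<P> \<Longrightarrow> (\<forall>v \<in> {..<1} <+> A. e v \<in> univ M) \<Longrightarrow> D e \<longleftrightarrow> sat M e (\<phi> D)"
    by metis
  have sat_iff: "sat M (case_sum c id) (\<phi> D) \<longleftrightarrow> D (case_sum (\<lambda>_. c 0) id)"
    if "D \<in> \<P>" "c 0 \<in> univ M" for D and c :: "nat \<Rightarrow> 'm"
  proof -
    have "sat M (case_sum c id) (\<phi> D) \<longleftrightarrow> sat M (case_sum (\<lambda>_. c 0) id) (\<phi> D)"
      using \<phi>(1)[OF that(1)] by (intro sat_cong) (auto simp: formulas_def)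
    also have "\<dots> \<longleftrightarrow> D (case_sum (\<lambda>_. c 0) id)"
      using that A by (intro \<phi>(2)[symmetric]) auto
    finally show ?thesis .
  qed
  have "realizations M {..<1::nat} q id \<noteq> {}" if q: "finite q" "q \<subseteq> \<phi> ` \<P>" for q
  proof -
    obtain \<Q> where \<Q>: "finite \<Q>" "\<Q> \<subseteq> \<P>" "q = \<phi> ` \<Q>"
      using finite_subset_image[OF q] by blast
    obtain x where x: "x \<in> univ M" "\<forall>D \<in> \<Q>. D (case_sum (\<lambda>_. x) id)"
      using fin[OF \<Q>(1,2)] by blast
    define c where "c = (\<lambda>i \<in> {..<1::nat}. x)"
    have "\<forall>D \<in> \<Q>. sat M (case_sum c id) (\<phi> D)"
    proof
      fix D
      assume "D \<in> \<Q>"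
      then show "sat M (case_sum c id) (\<phi> D)"
        using sat_iff[of D c] x \<Q>(2) by (auto simp: c_def)
    qed
    moreover have "c \<in> tuples M {..<1}"
      using x by (simp add: c_def tuples_def)
    ultimately have "c \<in> realizations M {..<1} q id"
      by (auto simp: realizations_def \<Q>(3))
    then show ?thesis
      by blast
  qed
  moreover have "\<phi> ` \<P> \<subseteq> formulas L ({..<1} <+> A)"
    using \<phi>(1) by blast
  ultimately have "realizations M {..<1::nat} (\<phi> ` \<P>) id \<noteq> {}"
    using saturated[unfolded saturated_def, rule_format, of A "\<phi> ` \<P>"] A by simp
  then obtain c where c: "c \<in> realizations M {..<1::nat} (\<phi> ` \<P>) id"
    by blast
  then have c0: "c 0 \<in> univ M"
    by (auto simp: realizations_def tuples_def)
  have "D (case_sum (\<lambda>_. c 0) id)" if "D \<in> \<P>" for D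
    using sat_iff[of D c, OF that c0] c that by (simp add: realizations_def)
  with c0 show ?thesis
    by blast
qed

lemma finite_small: "finite A \<Longrightarrow> |A| <o |univ M|"
  using infinite_univ by (intro finite_ordLess_infinite card_of_Well_order) (simp_all add: Field_card_of)

text \<open>Saturation is about a single variable. Countably many variables are treated by choosing
  their values one after the other, keeping every finite part of the type satisfiable by the
  remaining variables; values chosen earlier become parameters.\<close>

lemma compactness:
  fixes \<Gamma> :: "((nat + 'j \<Rightarrow> 'm) \<Rightarrow> bool) set" and \<alpha> :: "'j \<Rightarrow> 'm"
  assumes \<alpha>: "range \<alpha> \<subseteq> univ M" "|range \<alpha>| <o |univ M|"
    and def: "\<And>D. D \<in> \<Gamma> \<Longrightarrow> definable L M UNIV D"
    and fin: "\<And>\<Delta>. \<lbrakk>finite \<Delta>; \<Delta> \<subseteq> \<Gamma>\<rbrakk> \<Longrightarrow> \<exists>e. range e \<subseteq> univ M \<and> e \<circ> Inr = \<alpha> \<and> (\<forall>D \<in> \<Delta>. D e)"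
  shows "\<exists>e. range e \<subseteq> univ M \<and> e \<circ> Inr = \<alpha> \<and> (\<forall>D \<in> \<Gamma>. D e)"
proof -
  define ok where "ok m c \<longleftrightarrow> (\<forall>i<m. c i \<in> univ M) \<and> (\<forall>\<Delta>. finite \<Delta> \<and> \<Delta> \<subseteq> \<Gamma> \<longrightarrow>
      (\<exists>e. range e \<subseteq> univ M \<and> e \<circ> Inr = \<alpha> \<and> (\<forall>i<m. e (Inl i) = c i) \<and> (\<forall>D \<in> \<Delta>. D e)))"
    for m and c :: "nat \<Rightarrow> 'm"
  have step: "\<exists>c'. ok (Suc m) c' \<and> (\<forall>i<m. c' i = c i)" if ok: "ok m c" for m c
  proof -
    define A where "A = range \<alpha> \<union> c ` {..<m}"
    have A: "A \<subseteq> univ M" "|A| <o |univ M|"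
      using \<alpha> ok card_of_Un_ordLess_infinite[OF infinite_univ \<alpha>(2) finite_small, of "c ` {..<m}"]
      by (auto simp: A_def ok_def)
    \<comment> \<open>In \<open>E\<close>, the variables after the one numbered \<open>m\<close> are quantified; the map \<open>f\<close> turns those before it into
      parameters.\<close>
    define W :: "(nat + 'j) set" where "W = {Inl i | i. m < i}"
    define f :: "nat + 'j \<Rightarrow> nat + 'm" where
      "f = case_sum (\<lambda>i. if i < m then Inr (c i) else Inl 0) (\<lambda>j. Inr (\<alpha> j))"
    define E where "E \<Delta> = (\<lambda>e. \<exists>e'. (\<forall>v \<in> W. e' v \<in> univ M) \<and> (\<forall>v \<in> - W. e' v = e v) \<and>
        (\<forall>D \<in> \<Delta>. D e'))" for \<Delta> :: "((nat + 'j \<Rightarrow> 'm) \<Rightarrow> bool) set"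
    define \<P> where "\<P> = (\<lambda>\<Delta> e. E \<Delta> (e \<circ> f)) ` {\<Delta>. finite \<Delta> \<and> \<Delta> \<subseteq> \<Gamma>}"
    have "\<exists>x \<in> univ M. \<forall>D \<in> \<P>. D (case_sum (\<lambda>_. x) id)"
    proof (rule saturation[OF A])
      fix D
      assume "D \<in> \<P>"
      then obtain \<Delta> where \<Delta>: "finite \<Delta>" "\<Delta> \<subseteq> \<Gamma>" "D = (\<lambda>e. E \<Delta> (e \<circ> f))"
        by (auto simp: \<P>_def)
      have "definable L M (W \<union> - W) (\<lambda>e. \<forall>D \<in> \<Delta>. D e)"
        using \<Delta> def by (intro definable_ball) auto
      then have "definable L M (- W) (E \<Delta>)"
        unfolding E_def by (rule definable_ex_many[OF univ_nonempty]) simp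
      moreover have "f ` (- W) \<subseteq> {..<1} <+> A"
        by (auto simp: f_def A_def split: sum.split if_splits)
      moreover have "infinite (UNIV :: (nat + 'm) set)"
        by (simp add: finite_Plus_UNIV_iff)
      ultimately show "definable L M ({..<1} <+> A) D"
        unfolding \<Delta>(3) by (intro definable_rename)
    next
      fix \<Q>
      assume \<Q>: "finite \<Q>" "\<Q> \<subseteq> \<P>"
      obtain \<D> where \<D>: "finite \<D>" "\<D> \<subseteq> {\<Delta>. finite \<Delta> \<and> \<Delta> \<subseteq> \<Gamma>}" "\<Q> = (\<lambda>\<Delta> e. E \<Delta> (e \<circ> f)) ` \<D>"
        using finite_subset_image[OF \<Q>[unfolded \<P>_def]] by blast
      then have "finite (\<Union>\<D>)" "\<Union>\<D> \<subseteq> \<Gamma>"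
        by auto
      then obtain e where e: "range e \<subseteq> univ M" "e \<circ> Inr = \<alpha>" "\<forall>i<m. e (Inl i) = c i" "\<forall>D \<in> \<Union>\<D>. D e"
        using ok[unfolded ok_def, THEN conjunct2, rule_format, of "\<Union>\<D>"] by blast
      have "e v = (case_sum (\<lambda>_. e (Inl m)) id \<circ> f) v" if "v \<in> - W" for v
        using that e(2,3) by (cases v) (auto simp: f_def W_def fun_eq_iff not_less le_less)
      then have "E \<Delta> (case_sum (\<lambda>_. e (Inl m)) id \<circ> f)" if "\<Delta> \<in> \<D>" for \<Delta>
        unfolding E_def using e(1,4) that by (intro exI[of _ e]) auto
      then show "\<exists>x \<in> univ M. \<forall>D \<in> \<Q>. D (case_sum (\<lambda>_. x) id)"
        using e(1) by (intro bexI[of _ "e (Inl m)"]) (auto simp: \<D>(3))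
    qed
    then obtain x where x: "x \<in> univ M" "\<forall>D \<in> \<P>. D (case_sum (\<lambda>_. x) id)"
      by blast
    have "\<exists>e. range e \<subseteq> univ M \<and> e \<circ> Inr = \<alpha> \<and> (\<forall>i<Suc m. e (Inl i) = (c(m := x)) i) \<and> (\<forall>D \<in> \<Delta>. D e)"
      if "finite \<Delta>" "\<Delta> \<subseteq> \<Gamma>" for \<Delta>
    proof -
      have "E \<Delta> (case_sum (\<lambda>_. x) id \<circ> f)"
        using x(2) that by (auto simp: \<P>_def)
      then obtain e where e: "\<forall>v \<in> W. e v \<in> univ M"
          "\<And>v. v \<notin> W \<Longrightarrow> e v = (case_sum (\<lambda>_. x) id \<circ> f) v" "\<forall>D \<in> \<Delta>. D e"
        by (auto simp: E_def)
      have e_Inr: "e (Inr j) = \<alpha> j" for j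
        using e(2)[of "Inr j"] by (auto simp: f_def W_def)
      have e_Inl: "e (Inl i) = (c(m := x)) i" if "i < Suc m" for i
        using e(2)[of "Inl i"] that by (auto simp: f_def W_def)
      have "e v \<in> univ M" for v
      proof (cases "v \<in> W")
        case False
        then show ?thesis
          using e_Inr e_Inl \<alpha>(1) x(1) ok by (cases v) (auto simp: W_def ok_def)
      qed (use e(1) in blast)
      then show ?thesis
        using e_Inr e_Inl e(3) by (intro exI[of _ e]) auto
    qed
    then have "ok (Suc m) (c(m := x))"
      using ok x(1) by (auto simp: ok_def less_Suc_eq)
    then show ?thesis
      by (intro exI[of _ "c(m := x)"]) simp
  qed
  have "\<exists>c. ok 0 c"
    using fin by (auto simp: ok_def)
  then have "\<exists>c. \<forall>m. ok m (c m) \<and> (\<forall>i<m. c (Suc m) i = c m i)"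
    using step by (intro dependent_nat_choice) auto
  then obtain c where c: "\<And>m. ok m (c m)" "\<And>m i. i < m \<Longrightarrow> c (Suc m) i = c m i"
    by blast
  have c_eq: "c m i = c (Suc i) i" if "i < m" for m i
    using that
  proof (induction m)
    case (Suc m)
    then show ?case
      using c(2)[of i m] by (cases "i = m") auto
  qed simp
  define e where "e = case_sum (\<lambda>i. c (Suc i) i) \<alpha>"
  have e_univ: "e v \<in> univ M" for v
    using c(1) \<alpha>(1) by (cases v) (auto simp: e_def ok_def)
  have "D e" if D: "D \<in> \<Gamma>" for D
  proof -
    obtain F where F: "finite F" "\<forall>e e'. (\<forall>v \<in> UNIV. e v \<in> univ M) \<and> (\<forall>v \<in> UNIV. e' v \<in> univ M) \<and>
        (\<forall>v \<in> F. e v = e' v) \<longrightarrow> (D e \<longleftrightarrow> D e')"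
      using definable_support[OF def[OF D]] by blast
    have "finite (Inl -` F)"
      using F(1) by (intro finite_vimageI) auto
    then obtain m where m: "\<And>i. Inl i \<in> F \<Longrightarrow> i < m"
      by (auto simp: finite_nat_set_iff_bounded)
    obtain e' where e': "range e' \<subseteq> univ M" "e' \<circ> Inr = \<alpha>" "\<forall>i<m. e' (Inl i) = c m i" "D e'"
      using c(1)[of m, unfolded ok_def, THEN conjunct2, rule_format, of "{D}"] D by auto
    have "e v = e' v" if "v \<in> F" for v
      using that m e'(2,3) c_eq[of _ m] by (cases v) (auto simp: e_def fun_eq_iff)
    then show ?thesis
      using F(2)[rule_format, of e e'] e'(1,4) e_univ by auto
  qed
  then show ?thesis
    using e_univ by (intro exI[of _ e]) (auto simp: e_def)
qed

lemma compactness_countable: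
  fixes \<Gamma> :: "(('v :: countable \<Rightarrow> 'm) \<Rightarrow> bool) set"
  assumes def: "\<And>D. D \<in> \<Gamma> \<Longrightarrow> definable L M UNIV D"
    and fin: "\<And>\<Delta>. \<lbrakk>finite \<Delta>; \<Delta> \<subseteq> \<Gamma>\<rbrakk> \<Longrightarrow> \<exists>e. range e \<subseteq> univ M \<and> (\<forall>D \<in> \<Delta>. D e)"
  shows "\<exists>e. range e \<subseteq> univ M \<and> (\<forall>D \<in> \<Gamma>. D e)"
proof -
  obtain u where u: "u \<in> univ M"
    using univ_nonempty by blast
  define \<alpha> where "\<alpha> = (\<lambda>_ :: unit. u)"
  define f :: "'v \<Rightarrow> nat + unit" where "f = Inl \<circ> to_nat"
  have "\<exists>e. range e \<subseteq> univ M \<and> e \<circ> Inr = \<alpha> \<and> (\<forall>D \<in> (\<lambda>D e. D (e \<circ> f)) ` \<Gamma>. D e)"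
  proof (rule compactness)
    show "range \<alpha> \<subseteq> univ M" "|range \<alpha>| <o |univ M|"
      using u infinite_univ by (auto simp: \<alpha>_def intro: finite_small)
  next
    fix D
    assume "D \<in> (\<lambda>D e. D (e \<circ> f)) ` \<Gamma>"
    then show "definable L M UNIV D"
      using def by (auto intro!: definable_rename simp: finite_Plus_UNIV_iff)
  next
    fix \<Delta>
    assume \<Delta>: "finite \<Delta>" "\<Delta> \<subseteq> (\<lambda>D e. D (e \<circ> f)) ` \<Gamma>"
    obtain \<Delta>' where \<Delta>': "finite \<Delta>'" "\<Delta>' \<subseteq> \<Gamma>" "\<Delta> = (\<lambda>D e. D (e \<circ> f)) ` \<Delta>'"
      using finite_subset_image[OF \<Delta>] by blast
    obtain e where e: "range e \<subseteq> univ M" "\<forall>D \<in> \<Delta>'. D e"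
      using fin[OF \<Delta>'(1,2)] by blast
    have "case_sum (e \<circ> from_nat) \<alpha> \<circ> f = e"
      by (simp add: f_def fun_eq_iff)
    moreover have "range (case_sum (e \<circ> from_nat) \<alpha>) \<subseteq> univ M"
      using e(1) u by (auto simp: \<alpha>_def image_subset_iff split: sum.split)
    ultimately show "\<exists>e. range e \<subseteq> univ M \<and> e \<circ> Inr = \<alpha> \<and> (\<forall>D \<in> \<Delta>. D e)"
      using e(2) by (intro exI[of _ "case_sum (e \<circ> from_nat) \<alpha>"]) (auto simp: \<Delta>'(3))
  qed
  then obtain e where e: "range e \<subseteq> univ M" "\<forall>D \<in> \<Gamma>. D (e \<circ> f)"
    by auto
  then show ?thesis
    by (intro exI[of _ "e \<circ> f"]) auto
qed

end

section \<open>Extraction of indiscernible arrays\<close>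

text \<open>To apply Ramsey's theorem to a property of sequences that depends on the first \<open>K\<close>
  entries, a set of \<open>K\<close> numbers is coloured according to whether its increasing enumeration has
  the property. Finitely many properties are treated one after the other, by passing to
  subsequences.\<close>

lemma Ramsey_increasing:
  fixes \<C> :: "((nat \<Rightarrow> nat) \<Rightarrow> bool) set"
  assumes "finite \<C>"
    and dep: "\<And>C \<sigma> \<sigma>'. \<lbrakk>C \<in> \<C>; \<forall>r<K. \<sigma> r = \<sigma>' r\<rbrakk> \<Longrightarrow> C \<sigma> \<longleftrightarrow> C \<sigma>'"
  shows "\<exists>y :: nat \<Rightarrow> nat. strict_mono y \<and> (\<forall>C \<in> \<C>. \<forall>(\<sigma> :: nat \<Rightarrow> nat) \<sigma>'. strict_mono_on {..<K} \<sigma> \<longrightarrow> strict_mono_on {..<K} \<sigma>' \<longrightarrow>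
    (C (y \<circ> \<sigma>) \<longleftrightarrow> C (y \<circ> \<sigma>')))"
  using assms
proof (induction \<C> rule: finite_induct)
  case empty
  show ?case
    by (intro exI[of _ id]) (simp add: strict_mono_def)
next
  case (insert C \<C>)
  have "\<exists>y :: nat \<Rightarrow> nat. strict_mono y \<and> (\<forall>C \<in> \<C>. \<forall>(\<sigma> :: nat \<Rightarrow> nat) \<sigma>'. strict_mono_on {..<K} \<sigma> \<longrightarrow>
      strict_mono_on {..<K} \<sigma>' \<longrightarrow> (C (y \<circ> \<sigma>) \<longleftrightarrow> C (y \<circ> \<sigma>')))"
    by (intro insert.IH insert.prems insertI2)
  then obtain y :: "nat \<Rightarrow> nat" where y: "strict_mono y"
    "\<And>C \<sigma> \<sigma>'. \<lbrakk>C \<in> \<C>; strict_mono_on {..<K} \<sigma>; strict_mono_on {..<K} \<sigma>'\<rbrakk> \<Longrightarrow> C (y \<circ> \<sigma>) \<longleftrightarrow> C (y \<circ> \<sigma>')"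
    by blast
  define f where "f X = (if C (\<lambda>r. y (sorted_list_of_set X ! r)) then 1 else 0 :: nat)" for X
  have "\<exists>Y t. Y \<subseteq> UNIV \<and> infinite Y \<and> t < 2 \<and> (\<forall>X. X \<subseteq> Y \<and> finite X \<and> card X = K \<longrightarrow> f X = t)"
    by (rule Ramsey) (auto simp: f_def)
  then obtain Y t where Y: "infinite Y" "\<forall>X. X \<subseteq> Y \<and> finite X \<and> card X = K \<longrightarrow> f X = t"
    by blast
  define z where "z = enumerate Y"
  have z: "strict_mono z" "range z = Y"
    using Y(1) by (simp_all add: z_def strict_mono_enumerate range_enumerate)
  have mono_z: "strict_mono_on {..<K} (z \<circ> \<sigma>)" if "strict_mono_on {..<K} \<sigma>" for \<sigma>
    using that z(1) by (auto simp: strict_mono_on_def strict_mono_def)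
  have C_eq: "C (y \<circ> (z \<circ> \<sigma>)) \<longleftrightarrow> t = 1" if \<sigma>: "strict_mono_on {..<K} \<sigma>" for \<sigma>
  proof -
    define X where "X = (z \<circ> \<sigma>) ` {..<K}"
    have inj: "inj_on (z \<circ> \<sigma>) {..<K}"
      using mono_z[OF \<sigma>] by (rule strict_mono_on_imp_inj_on)
    have "sorted_wrt (<) (map (z \<circ> \<sigma>) [0..<K])"
      using mono_z[OF \<sigma>] by (auto simp: sorted_wrt_iff_nth_less strict_mono_on_def)
    then have "sorted_list_of_set (set (map (z \<circ> \<sigma>) [0..<K])) = map (z \<circ> \<sigma>) [0..<K]"
      unfolding strict_sorted_iff by (intro sorted_list_of_set.idem_if_sorted_distinct) simp_all
    moreover have "set (map (z \<circ> \<sigma>) [0..<K]) = X"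
      by (simp add: X_def atLeast0LessThan)
    ultimately have "sorted_list_of_set X = map (z \<circ> \<sigma>) [0..<K]"
      by simp
    then have "C (\<lambda>r. y (sorted_list_of_set X ! r)) \<longleftrightarrow> C (y \<circ> (z \<circ> \<sigma>))"
      by (intro insert.prems[of C]) auto
    moreover have "f X = t"
      using z(2) card_image[OF inj] by (intro Y(2)[rule_format]) (auto simp: X_def)
    ultimately show ?thesis
      by (auto simp: f_def split: if_splits)
  qed
  show ?case
  proof (intro exI[of _ "y \<circ> z"] conjI ballI allI impI)
    show "strict_mono (y \<circ> z)"
      using y(1) z(1) by (auto simp: strict_mono_def)
    fix C' and \<sigma> \<sigma>' :: "nat \<Rightarrow> nat"
    assume *: "C' \<in> insert C \<C>" "strict_mono_on {..<K} \<sigma>" "strict_mono_on {..<K} \<sigma>'"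
    then show "C' (y \<circ> z \<circ> \<sigma>) \<longleftrightarrow> C' (y \<circ> z \<circ> \<sigma>')"
      using C_eq y(2)[of C' "z \<circ> \<sigma>" "z \<circ> \<sigma>'"] mono_z by (auto simp: comp_assoc)
  qed
qed

lemma block_less:
  fixes g :: "nat \<Rightarrow> nat \<Rightarrow> nat"
  assumes less: "r < r'" and T: "0 < T"
    and mono: "\<And>t t'. \<lbrakk>t < t'; t' < T\<rbrakk> \<Longrightarrow> g (r div T) t < g (r div T) t'"
    and bound: "\<And>t. t < T \<Longrightarrow> g (r div T) t < P"
  shows "(r div T) * P + g (r div T) (r mod T) < (r' div T) * P + g (r' div T) (r' mod T)"
proof -
  have "r div T \<le> r' div T"
    using less by (simp add: div_le_mono)
  then consider "r div T = r' div T" | "Suc (r div T) \<le> r' div T"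
    by linarith
  then show ?thesis
  proof cases
    case 1
    have "r mod T < r' mod T"
      using less 1 by (metis div_mult_mod_eq nat_add_left_cancel_less)
    then show ?thesis
      using 1 T mono by simp
  next
    case 2
    have "(r div T) * P + g (r div T) (r mod T) < Suc (r div T) * P"
      using bound T by simp
    also have "\<dots> \<le> (r' div T) * P"
      using 2 by (rule mult_le_mono1)
    finally show ?thesis
      by linarith
  qed
qed

text \<open>In the proof of the extraction lemma, the columns of row \<open>i\<close> are taken from the block
  \<open>{i * P..<(i + 1) * P}\<close> of a sequence. Choosing entries \<open>g i t\<close> in each block increasingly then
  gives an increasing choice from the whole sequence.\<close>

lemma strict_mono_on_block:
  fixes g :: "nat \<Rightarrow> nat \<Rightarrow> nat"
  assumes mono: "\<And>i t t'. \<lbrakk>t < t'; t' < T\<rbrakk> \<Longrightarrow> g i t < g i t'"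
    and bound: "\<And>i t. \<lbrakk>i < T; t < T\<rbrakk> \<Longrightarrow> g i t < P"
  shows "strict_mono_on {..<T * T} (\<lambda>r. (r div T) * P + g (r div T) (r mod T))"
proof (rule strict_mono_onI)
  fix r r' :: nat
  assume r: "r \<in> {..<T * T}" "r' \<in> {..<T * T}" "r < r'"
  then have "0 < T" "r div T < T"
    by (cases T, auto simp: less_mult_imp_div_less)
  with r(3) show "(r div T) * P + g (r div T) (r mod T) < (r' div T) * P + g (r' div T) (r' mod T)"
    using mono bound by (intro block_less) auto
qed

lemma strict_mono_extension:
  fixes s :: "nat \<Rightarrow> nat"
  assumes "strict_mono_on {..<K} s"
  shows "\<exists>s'. strict_mono s' \<and> (\<forall>r<K. s' r = s r)"
proof -
  obtain B where B: "\<forall>x \<in> s ` {..<K}. x < B"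
    using finite_nat_set_iff_bounded by blast
  define s' where "s' r = (if r < K then s r else B + r)" for r
  have "s' r < s' r'" if "r < r'" for r r'
    using assms that B by (auto simp: s'_def strict_mono_on_def intro: trans_less_add1)
  then show ?thesis
    by (intro exI[of _ s']) (auto simp: s'_def strict_mono_def)
qed

context saturated_structure
begin

text \<open>The rows of an array are mutually indiscernible as soon as the array can be thinned out
  simultaneously and independently in all its rows without changing its type: parameters from the
  other rows are absorbed by leaving those rows unchanged. Taking the coordinates of the tuples in
  \<^typ>\<open>nat\<close> is harmless, since a formula uses finitely many of them. The array has infinitely many
  rows; a statement about \<open>N\<close> rows uses the first \<open>N\<close>.\<close>

definition indiscernible_array :: "(nat \<Rightarrow> nat \<Rightarrow> nat \<Rightarrow> 'm) \<Rightarrow> bool" where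
  "indiscernible_array b \<longleftrightarrow> (\<forall>i j q. b i j q \<in> univ M) \<and>
     (\<forall>D s. definable L M UNIV D \<and> (\<forall>i. strict_mono (s i)) \<longrightarrow>
        (D (\<lambda>(i, t, q). b i t q) \<longleftrightarrow> D (\<lambda>(i, t, q). b i (s i t) q)))"

text \<open>The type to be realized says that \<open>D0\<close> holds and that thinning out the rows does not
  change the truth value of any definable predicate. A finite part of it involves finitely many
  rows and columns. Ramsey's theorem, applied to increasing sequences of columns of \<open>b\<close>, provides
  a sequence of columns on which these finitely many predicates do not depend on the increasing
  choice; cut into consecutive blocks, one for each row, it realizes the finite part. This is why
  \<open>D0\<close> is only required for choices of columns that increase from each row to the next.\<close>

lemma extract_indiscernible_array:
  fixes b :: "nat \<Rightarrow> nat \<Rightarrow> nat \<Rightarrow> 'm"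
  assumes b: "\<And>i j q. b i j q \<in> univ M"
    and D0: "definable L M UNIV D0"
    and hom: "\<And>y P. \<lbrakk>strict_mono y; 2 \<le> P\<rbrakk> \<Longrightarrow> D0 (\<lambda>(i, t, q). b i (y (i * P + t)) q)"
  shows "\<exists>b'. indiscernible_array b' \<and> D0 (\<lambda>(i, t, q). b' i t q)"
proof -
  define Z where "Z = {(D :: (nat \<times> nat \<times> nat \<Rightarrow> 'm) \<Rightarrow> bool, s :: nat \<Rightarrow> nat \<Rightarrow> nat). definable L M UNIV D \<and> (\<forall>i. strict_mono (s i))}"
  define R where "R = (\<lambda>(D :: (nat \<times> nat \<times> nat \<Rightarrow> 'm) \<Rightarrow> bool, s) e. D e \<longleftrightarrow> D (e \<circ> (\<lambda>(i, t, q). (i, s i t, q))))"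
  have "\<exists>e. range e \<subseteq> univ M \<and> (\<forall>D \<in> insert D0 (R ` Z). D e)"
  proof (rule compactness_countable)
    fix D
    assume "D \<in> insert D0 (R ` Z)"
    then show "definable L M UNIV D"
      using D0 by (auto simp: R_def Z_def finite_prod intro!: definable_iff definable_rename)
  next
    fix \<Delta>
    assume \<Delta>: "finite \<Delta>" "\<Delta> \<subseteq> insert D0 (R ` Z)"
    then have "\<Delta> - {D0} \<subseteq> R ` Z" "finite (\<Delta> - {D0})"
      by auto
    then obtain Q where Q: "finite Q" "Q \<subseteq> Z" "\<Delta> - {D0} = R ` Q"
      using finite_subset_image by meson
    have "\<forall>D \<in> fst ` Q. \<exists>F. finite F \<and> (\<forall>e e'. (\<forall>v \<in> UNIV. e v \<in> univ M) \<and> (\<forall>v \<in> UNIV. e' v \<in> univ M) \<and>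
        (\<forall>v \<in> F. e v = e' v) \<longrightarrow> (D e \<longleftrightarrow> D e'))"
      using Q(2) by (intro ballI definable_support) (auto simp: Z_def)
    from bchoice[OF this] obtain F where F: "\<forall>D \<in> fst ` Q. finite (F D) \<and>
        (\<forall>e e'. (\<forall>v \<in> UNIV. e v \<in> univ M) \<and> (\<forall>v \<in> UNIV. e' v \<in> univ M) \<and>
        (\<forall>v \<in> F D. e v = e' v) \<longrightarrow> (D e \<longleftrightarrow> D e'))"
      ..
    have "finite (\<Union>D \<in> fst ` Q. (fst ` F D) \<union> ((fst \<circ> snd) ` F D))"
      using F Q(1) by blast
    then obtain T where "\<forall>x \<in> (\<Union>D \<in> fst ` Q. (fst ` F D) \<union> ((fst \<circ> snd) ` F D)). x < T"
      unfolding finite_nat_set_iff_bounded ..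
    then have T: "i < T \<and> t < T" if "D \<in> fst ` Q" "(i, t, q) \<in> F D" for D i t q
      using that by force
    have D_cong: "D (\<lambda>(i, t, q). b i (g i t) q) \<longleftrightarrow> D (\<lambda>(i, t, q). b i (g' i t) q)"
      if D: "D \<in> fst ` Q" and eq: "\<And>i t. \<lbrakk>i < T; t < T\<rbrakk> \<Longrightarrow> g i t = g' i t" for D g g'
    proof (rule F[rule_format, OF D, THEN conjunct2, rule_format], intro conjI ballI)
      fix v
      assume "v \<in> F D"
      then show "(\<lambda>(i, t, q). b i (g i t) q) v = (\<lambda>(i, t, q). b i (g' i t) q) v"
        using T[OF D] eq by (cases v) auto
    qed (use b in \<open>auto split: prod.split\<close>)
    have "finite (\<Union>s \<in> snd ` Q. (\<lambda>(i, t). s i t) ` ({..<T} \<times> {..<T}))"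
      using Q(1) by blast
    then obtain P0 where "\<forall>x \<in> (\<Union>s \<in> snd ` Q. (\<lambda>(i, t). s i t) ` ({..<T} \<times> {..<T})). x < P0"
      unfolding finite_nat_set_iff_bounded ..
    then have P0: "s i t < P0" if "s \<in> snd ` Q" "i < T" "t < T" for s i t
      using that by fast
    define P where "P = P0 + T + 2"
    \<comment> \<open>Only rows and columns below \<open>T\<close> matter; the entry \<open>(i, t)\<close> is listed at position \<open>i * T + t\<close>.\<close>
    define C where "C D \<sigma> = D (\<lambda>(i, t, q). b i (\<sigma> (i * T + t)) q)"
      for D :: "(nat \<times> nat \<times> nat \<Rightarrow> 'm) \<Rightarrow> bool" and \<sigma> :: "nat \<Rightarrow> nat"
    have dep: "C D \<sigma> \<longleftrightarrow> C D \<sigma>'" if D: "D \<in> fst ` Q" and eq: "\<forall>r<T * T. \<sigma> r = \<sigma>' r" for D \<sigma> \<sigma>'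
    proof -
      have "i * T + t < T * T" if "i < T" "t < T" for i t
      proof -
        have "i * T + t < Suc i * T"
          using that by simp
        also have "\<dots> \<le> T * T"
          using that by (intro mult_le_mono1) simp
        finally show ?thesis .
      qed
      then show ?thesis
        unfolding C_def using D eq by (intro D_cong) auto
    qed
    have "\<exists>y :: nat \<Rightarrow> nat. strict_mono y \<and> (\<forall>C' \<in> C ` fst ` Q. \<forall>(\<sigma> :: nat \<Rightarrow> nat) \<sigma>'.
        strict_mono_on {..<T * T} \<sigma> \<longrightarrow> strict_mono_on {..<T * T} \<sigma>' \<longrightarrow> (C' (y \<circ> \<sigma>) \<longleftrightarrow> C' (y \<circ> \<sigma>')))"
    proof (rule Ramsey_increasing)
      show "finite (C ` fst ` Q)"
        using Q(1) by simp
      show "C' \<sigma> \<longleftrightarrow> C' \<sigma>'" if C': "C' \<in> C ` fst ` Q" and "\<forall>r<T * T. \<sigma> r = \<sigma>' r" for C' \<sigma> \<sigma>'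
      proof -
        obtain D where "C' = C D" "D \<in> fst ` Q"
          using C' by (rule imageE)
        with dep[of D, OF _ that(2)] show ?thesis
          by simp
      qed
    qed
    then obtain y :: "nat \<Rightarrow> nat" where y: "strict_mono y" "\<forall>C' \<in> C ` fst ` Q. \<forall>(\<sigma> :: nat \<Rightarrow> nat) \<sigma>'.
        strict_mono_on {..<T * T} \<sigma> \<longrightarrow> strict_mono_on {..<T * T} \<sigma>' \<longrightarrow> (C' (y \<circ> \<sigma>) \<longleftrightarrow> C' (y \<circ> \<sigma>'))"
      by blast
    define e where "e = (\<lambda>(i, t, q). b i (y (i * P + t)) q)"
    have C_eq: "D (\<lambda>(i, t, q). b i (y (i * P + s i t)) q) \<longleftrightarrow>
        C D (y \<circ> (\<lambda>r. (r div T) * P + s (r div T) (r mod T)))" if D: "D \<in> fst ` Q" for D s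
      unfolding C_def using D by (intro D_cong) auto
    have "R z e" if z: "z \<in> Q" for z
    proof -
      obtain D s where Ds: "z = (D, s)"
        by (cases z)
      have D: "D \<in> fst ` Q" and s: "s \<in> snd ` Q" "\<And>i. strict_mono (s i)"
        using z Q(2) by (force simp: Ds Z_def)+
      have "strict_mono_on {..<T * T} (\<lambda>r. (r div T) * P + s (r div T) (r mod T))"
        using s(2) P0[OF s(1)] by (intro strict_mono_on_block) (auto simp: strict_mono_def P_def intro: less_trans[of _ P0])
      moreover have "strict_mono_on {..<T * T} (\<lambda>r. (r div T) * P + r mod T)"
        by (rule strict_mono_on_block) (auto simp: P_def)
      ultimately have "C D (y \<circ> (\<lambda>r. (r div T) * P + r mod T)) \<longleftrightarrow>
          C D (y \<circ> (\<lambda>r. (r div T) * P + s (r div T) (r mod T)))"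
        by (intro y(2)[rule_format] imageI D)
      moreover have "e \<circ> (\<lambda>(i, t, q). (i, s i t, q)) = (\<lambda>(i, t, q). b i (y (i * P + s i t)) q)"
        by (auto simp: e_def)
      ultimately show ?thesis
        using C_eq[OF D, of "\<lambda>_ t. t"] C_eq[OF D, of s] by (simp add: R_def Ds e_def)
    qed
    then have "\<forall>D \<in> R ` Q. D e"
      by blast
    moreover have "D0 e"
      unfolding e_def using y(1) by (intro hom) (auto simp: P_def)
    ultimately have "\<forall>D \<in> \<Delta>. D e"
      using Q(3) by blast
    moreover have "range e \<subseteq> univ M"
      using b by (auto simp: e_def)
    ultimately show "\<exists>e. range e \<subseteq> univ M \<and> (\<forall>D \<in> \<Delta>. D e)"
      by blast
  qed
  then obtain e where e: "range e \<subseteq> univ M" "D0 e" "\<forall>z \<in> Z. R z e"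
    by auto
  define b' where "b' i t q = e (i, t, q)" for i t q
  have [simp]: "(\<lambda>(i, t, q). b' i t q) = e"
    by (auto simp: b'_def)
  have "D e \<longleftrightarrow> D (\<lambda>(i, t, q). b' i (s i t) q)"
    if "definable L M UNIV D" "\<forall>i. strict_mono (s i)" for D s
  proof -
    have "e \<circ> (\<lambda>(i, t, q). (i, s i t, q)) = (\<lambda>(i, t, q). b' i (s i t) q)"
      by (auto simp: b'_def)
    moreover have "R (D, s) e"
      using e(3) that by (auto simp: Z_def)
    ultimately show ?thesis
      by (simp add: R_def)
  qed
  moreover have "b' i j q \<in> univ M" for i j q
    using e(1) by (auto simp: b'_def)
  ultimately have "indiscernible_array b'"
    unfolding indiscernible_array_def by simp
  with e(2) show ?thesis
    by (intro exI[of _ b']) simp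
qed

section \<open>Patterns witnessing dp-rank\<close>

text \<open>A configuration as in the definition of bounded dp-rank, for a \<open>k\<close>-tuple \<open>c\<close>, but with an
  arbitrary array: in exchange, \<open>c\<close> must exist for every choice of pairs of columns
  \<open>\<sigma> (2 * i) < \<sigma> (2 * i + 1)\<close> that increases from each row to the next. Both the sequence of
  parameters of a family of subgroups and the induction on \<open>k\<close> provide patterns of this weak kind.\<close>

definition dp_pattern :: "nat \<Rightarrow> nat \<Rightarrow> bool" where
  "dp_pattern k N \<longleftrightarrow> (\<exists>P b. (\<forall>i<N. definable L M ({..<k} <+> (UNIV :: nat set)) (P i)) \<and>
     (\<forall>i j q. b i j q \<in> univ M) \<and>
     (\<forall>\<sigma> :: nat \<Rightarrow> nat. strict_mono \<sigma> \<longrightarrow> (\<exists>c \<in> {..<k} \<rightarrow> univ M. \<forall>i<N.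
        P i (case_sum c (b i (\<sigma> (2 * i)))) \<and> \<not> P i (case_sum c (b i (\<sigma> (2 * i + 1)))))))"

definition indiscernible_dp_pattern :: "nat \<Rightarrow> nat \<Rightarrow> bool" where
  "indiscernible_dp_pattern k N \<longleftrightarrow>
     (\<exists>P b. (\<forall>i<N. definable L M ({..<k} <+> (UNIV :: nat set)) (P i)) \<and> indiscernible_array b \<and>
        (\<exists>c \<in> {..<k} \<rightarrow> univ M. \<forall>i<N. P i (case_sum c (b i 0)) \<and> \<not> P i (case_sum c (b i 1))))"

text \<open>The existence of \<open>c\<close> is a definable condition on the array and can be preserved by the
  extraction.\<close>

lemma dp_pattern_imp_indiscernible:
  assumes "dp_pattern k N"
  shows "indiscernible_dp_pattern k N"
proof -
  obtain P and b :: "nat \<Rightarrow> nat \<Rightarrow> nat \<Rightarrow> 'm" where P: "\<forall>i<N. definable L M ({..<k} <+> (UNIV :: nat set)) (P i)"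
    and b: "\<forall>i j q. b i j q \<in> univ M"
    and Pb: "\<forall>\<sigma> :: nat \<Rightarrow> nat. strict_mono \<sigma> \<longrightarrow> (\<exists>c \<in> {..<k} \<rightarrow> univ M. \<forall>i<N.
        P i (case_sum c (b i (\<sigma> (2 * i)))) \<and> \<not> P i (case_sum c (b i (\<sigma> (2 * i + 1)))))"
    using assms unfolding dp_pattern_def by (elim exE conjE) (rule that)
  define f :: "nat \<Rightarrow> nat \<Rightarrow> nat + nat \<Rightarrow> nat + nat \<times> nat \<times> nat" where
    "f i t = case_sum Inl (\<lambda>q. Inr (i, t, q))" for i t
  have f: "case_sum c e \<circ> f i t = case_sum c (\<lambda>q. e (i, t, q))" for c :: "nat \<Rightarrow> 'm" and e i t
    by (auto simp: f_def fun_eq_iff split: sum.split)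
  define D0 where "D0 e \<longleftrightarrow> (\<exists>c \<in> {..<k} \<rightarrow> univ M. \<forall>i \<in> {..<N}.
      P i (case_sum c e \<circ> f i 0) \<and> \<not> P i (case_sum c e \<circ> f i 1))" for e
  have "definable L M UNIV D0"
    unfolding D0_def
  proof (rule definable_ex_left[OF univ_nonempty])
    show "definable L M ({..<k} <+> UNIV) (\<lambda>e. \<forall>i \<in> {..<N}. P i (e \<circ> f i 0) \<and> \<not> P i (e \<circ> f i 1))"
    proof -
      have "definable L M ({..<k} <+> UNIV) (\<lambda>e. P i (e \<circ> f i t))" if "i \<in> {..<N}" for i t
        using P that by (intro definable_rename[of _ _ "{..<k} <+> UNIV"]) (auto simp: f_def finite_Plus_UNIV_iff finite_prod)
      then show ?thesis
        by (intro definable_ball definable_and definable_not) simp_all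
    qed
  qed (simp add: finite_prod)
  moreover have "D0 (\<lambda>(i, t, q). b i (y (i * p + t)) q)" if y: "strict_mono y" "2 \<le> p" for y :: "nat \<Rightarrow> nat" and p
  proof -
    have "strict_mono (\<lambda>r :: nat. y ((r div 2) * p + r mod 2))"
    proof (rule strict_monoI)
      fix r r' :: nat
      assume "r < r'"
      then have "(r div 2) * p + r mod 2 < (r' div 2) * p + r' mod 2"
        using y(2) by (intro block_less[where g = "\<lambda>_ t. t"]) auto
      then show "y ((r div 2) * p + r mod 2) < y ((r' div 2) * p + r' mod 2)"
        using y(1) by (simp add: strict_mono_def)
    qed
    then show ?thesis
      using Pb[rule_format, of "\<lambda>r. y ((r div 2) * p + r mod 2)"] by (auto simp: D0_def f)
  qed
  ultimately obtain b' where b': "indiscernible_array b'" "D0 (\<lambda>(i, t, q). b' i t q)"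
    using extract_indiscernible_array[of b D0] b by blast
  then show ?thesis
    using P unfolding indiscernible_dp_pattern_def
    by (intro exI[of _ P] exI[of _ b']) (auto simp: D0_def f)
qed

text \<open>Without variables, the formula of row \<open>0\<close> would hold or fail at column \<open>1\<close> according to
  whether this column is chosen as the first or as the second one of a pair.\<close>

lemma no_dp_pattern_0:
  assumes "dp_pattern 0 N"
  shows "N = 0"
proof (rule ccontr)
  assume N: "N \<noteq> 0"
  obtain P and b :: "nat \<Rightarrow> nat \<Rightarrow> nat \<Rightarrow> 'm" where P: "\<forall>i<N. definable L M ({..<0::nat} <+> (UNIV :: nat set)) (P i)"
    and b: "\<forall>i j q. b i j q \<in> univ M"
    and Pb: "\<forall>\<sigma> :: nat \<Rightarrow> nat. strict_mono \<sigma> \<longrightarrow> (\<exists>c \<in> {..<0} \<rightarrow> univ M. \<forall>i<N.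
        P i (case_sum c (b i (\<sigma> (2 * i)))) \<and> \<not> P i (case_sum c (b i (\<sigma> (2 * i + 1)))))"
    using assms unfolding dp_pattern_def by (elim exE conjE) (rule that)
  obtain c where "\<not> P 0 (case_sum c (b 0 1))"
    using Pb[rule_format, of id] N by (force simp: strict_mono_def)
  moreover obtain c' where "P 0 (case_sum c' (b 0 1))"
    using Pb[rule_format, of Suc] N by (force simp: strict_mono_def)
  moreover have "P 0 (case_sum c (b 0 1)) \<longleftrightarrow> P 0 (case_sum c' (b 0 1))"
    using P N b by (intro definable_agree[of L M "{..<0::nat} <+> UNIV"]) auto
  ultimately show False
    by simp
qed

text \<open>Indiscernibility of row \<open>i0\<close> over the other rows is a case of simultaneous thinning: a
  formula with parameters becomes one without when each parameter is read off at its position in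
  the array.\<close>

lemma not_indiscernible_dp_pattern:
  assumes bound: "\<not> (\<exists>(m :: nat \<Rightarrow> nat) (\<phi> :: nat \<Rightarrow> ('f, 'r, nat + nat) fm) a.
        (\<forall>i<n. \<phi> i \<in> formulas L ({..<1} <+> {..<m i})) \<and>
        indiscernible_array_over L M {} n (\<lambda>i. {..<m i}) a \<and>
        (\<exists>c \<in> tuples M {..<1}. \<forall>i<n.
           sat M (case_sum c (a i 0)) (\<phi> i) \<and> \<not> sat M (case_sum c (a i 1)) (\<phi> i)))"
  shows "\<not> indiscernible_dp_pattern 1 n"
proof
  assume "indiscernible_dp_pattern 1 n"
  then obtain P and b :: "nat \<Rightarrow> nat \<Rightarrow> nat \<Rightarrow> 'm" where P: "\<forall>i<n. definable L M ({..<1::nat} <+> (UNIV :: nat set)) (P i)"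
    and ind: "indiscernible_array b"
    and Pb: "\<exists>c \<in> {..<1} \<rightarrow> univ M. \<forall>i<n. P i (case_sum c (b i 0)) \<and> \<not> P i (case_sum c (b i 1))"
    unfolding indiscernible_dp_pattern_def by (elim exE conjE) (rule that)
  obtain c where c: "c \<in> {..<1} \<rightarrow> univ M" "\<forall>i<n. P i (case_sum c (b i 0)) \<and> \<not> P i (case_sum c (b i 1))"
    using Pb by blast
  have b: "b i j q \<in> univ M" for i j q
    using ind by (simp add: indiscernible_array_def)
  have "\<forall>i \<in> {..<n}. \<exists>\<phi>. \<phi> \<in> formulas L ({..<1} <+> UNIV) \<and>
      (\<forall>e. (\<forall>v \<in> {..<1} <+> UNIV. e v \<in> univ M) \<longrightarrow> (P i e \<longleftrightarrow> sat M e \<phi>))"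
    using P by (simp add: definable_def Bex_def)
  from bchoice[OF this] obtain \<phi> where \<phi>: "\<forall>i \<in> {..<n}. \<phi> i \<in> formulas L ({..<1} <+> UNIV) \<and>
      (\<forall>e. (\<forall>v \<in> {..<1} <+> UNIV. e v \<in> univ M) \<longrightarrow> (P i e \<longleftrightarrow> sat M e (\<phi> i)))"
    ..
  have "\<exists>m. \<forall>q \<in> Inr -` fv (\<phi> i). q < m" for i
    unfolding finite_nat_set_iff_bounded[symmetric] by (intro finite_vimageI finite_fv) simp
  then obtain m where m: "\<And>i q. Inr q \<in> fv (\<phi> i) \<Longrightarrow> q < m i"
    by (metis vimageI)
  define a where "a i j = restrict (b i j) {..<m i}" for i j
  define c' where "c' = restrict c {..<1}"
  have \<phi>_form: "\<phi> i \<in> formulas L ({..<1} <+> {..<m i})" if "i < n" for i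
    using \<phi> that m by (fastforce simp: formulas_def)
  have sat_a: "sat M (case_sum c' (a i j)) (\<phi> i) \<longleftrightarrow> P i (case_sum c (b i j))" if "i < n" for i j
  proof -
    have "\<forall>v \<in> {..<1} <+> UNIV. case_sum c (b i j) v \<in> univ M"
      using c(1) b by auto
    then have "P i (case_sum c (b i j)) \<longleftrightarrow> sat M (case_sum c (b i j)) (\<phi> i)"
      using \<phi> that by simp
    also have "\<dots> \<longleftrightarrow> sat M (case_sum c' (a i j)) (\<phi> i)"
      using \<phi>_form[OF that] by (intro sat_cong) (auto simp: formulas_def c'_def a_def)
    finally show ?thesis
      by simp
  qed
  have "indiscernible_over L M ({} \<union> (\<Union>i \<in> {..<n} - {i0}. \<Union>j. a i j ` {..<m i})) {..<m i0} (a i0)" for i0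
    unfolding indiscernible_over_def
  proof (intro conjI allI ballI impI)
    show "a i0 j \<in> tuples M {..<m i0}" for j
      using b by (auto simp: a_def tuples_def)
  next
    define A where "A = {} \<union> (\<Union>i \<in> {..<n} - {i0}. \<Union>j. a i j ` {..<m i})"
    fix n' \<psi> and s s' :: "nat \<Rightarrow> nat"
    assume \<psi>: "\<psi> \<in> formulas L (({..<n'} \<times> {..<m i0}) <+> ({} \<union> (\<Union>i \<in> {..<n} - {i0}. \<Union>j. a i j ` {..<m i})))"
      and s: "strict_mono_on {..<n'} s \<and> strict_mono_on {..<n'} s'"
    \<comment> \<open>Each parameter is an entry of another row; rows other than \<open>i0\<close> are left unchanged.\<close>
    have "\<forall>x \<in> A. \<exists>z. case z of (i, j, q) \<Rightarrow> i \<noteq> i0 \<and> b i j q = x"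
      by (force simp: A_def a_def)
    from bchoice[OF this] obtain g where g: "\<forall>x \<in> A. case g x of (i, j, q) \<Rightarrow> i \<noteq> i0 \<and> b i j q = x"
      ..
    define f :: "nat \<times> nat + 'm \<Rightarrow> nat \<times> nat \<times> nat" where "f = case_sum (\<lambda>(t, q). (i0, t, q)) g"
    define D where "D = (\<lambda>e. sat M (e \<circ> f) \<psi>)"
    have "definable L M UNIV D"
      unfolding D_def using \<psi> by (intro definable_rename[OF _ definable_sat]) (auto simp: finite_prod)
    then have D_eq: "D (\<lambda>(i, t, q). b i t q) \<longleftrightarrow> D (\<lambda>(i, t, q). b i (if i = i0 then r t else t) q)"
      if "strict_mono r" for r
      using ind[unfolded indiscernible_array_def, THEN conjunct2, rule_format,
          of D "\<lambda>i t. if i = i0 then r t else t"] that by (auto simp: strict_mono_def)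
    have "sat M (case_sum (\<lambda>(t, j). a i0 (r t) j) id) \<psi> \<longleftrightarrow> D (\<lambda>(i, t, q). b i t q)"
      if r: "strict_mono_on {..<n'} r" for r
    proof -
      obtain r' where r': "strict_mono r'" "\<forall>t<n'. r' t = r t"
        using strict_mono_extension[OF r] by blast
      have "sat M (case_sum (\<lambda>(t, j). a i0 (r t) j) id) \<psi> \<longleftrightarrow>
          sat M ((\<lambda>(i, t, q). b i (if i = i0 then r' t else t) q) \<circ> f) \<psi>"
      proof (rule sat_cong)
        fix v
        assume "v \<in> fv \<psi>"
        then have "v \<in> ({..<n'} \<times> {..<m i0}) <+> A"
          using \<psi> by (auto simp: formulas_def A_def)
        then show "case_sum (\<lambda>(t, j). a i0 (r t) j) id v =
            ((\<lambda>(i, t, q). b i (if i = i0 then r' t else t) q) \<circ> f) v"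
          using g r'(2) by (auto simp: f_def a_def split: prod.split)
      qed
      then show ?thesis
        using D_eq[OF r'(1)] by (simp add: D_def)
    qed
    with s show "sat M (case_sum (\<lambda>(t, j). a i0 (s t) j) id) \<psi> \<longleftrightarrow>
        sat M (case_sum (\<lambda>(t, j). a i0 (s' t) j) id) \<psi>"
      by simp
  qed
  then have "indiscernible_array_over L M {} n (\<lambda>i. {..<m i}) a"
    by (simp add: indiscernible_array_over_def)
  moreover have "c' \<in> tuples M {..<1}"
    using c(1) by (auto simp: c'_def tuples_def)
  ultimately show False
    using bound \<phi>_form sat_a c(2) by blast
qed

section \<open>Bounded dp-rank for tuples\<close>

text \<open>This is the passage from single variables to tuples. The \<open>n * m\<close> rows are grouped into
  \<open>n\<close> blocks of \<open>m\<close> rows. Let \<open>c\<close> realize the pattern at the columns \<open>0\<close> and \<open>1\<close>. For a block \<open>l\<close>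
  and a choice of a pair of columns in each of its rows, let \<open>\<Theta> l\<close> say about the last coordinate
  of \<open>c\<close> that the remaining \<open>k\<close> coordinates can be chosen such that the pattern is realized in
  this block at these pairs. At the columns \<open>0\<close> and \<open>1\<close>, this holds in all blocks.

  If, in some block, it also holds at all later pairs, then the last coordinate may be regarded as
  a parameter, and this block is a pattern with \<open>k\<close> variables and \<open>m\<close> rows. Otherwise, \<open>\<Theta> l\<close> fails
  at some later pairs in every block. Regarding a block as a single row, with the tuples of pairs
  as its entries, the formulas \<open>\<Theta> l\<close> form a pattern with one variable and \<open>n\<close> rows.\<close>

lemma dp_pattern_drop_variable:
  assumes pat: "indiscernible_dp_pattern (Suc k) (n * m)" and m: "0 < m"
    and bound: "\<not> indiscernible_dp_pattern 1 n"
  shows "dp_pattern k m"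
proof -
  obtain P and b :: "nat \<Rightarrow> nat \<Rightarrow> nat \<Rightarrow> 'm" where
        P: "\<forall>i<n * m. definable L M ({..<Suc k} <+> (UNIV :: nat set)) (P i)"
    and ind: "indiscernible_array b"
    and Pb: "\<exists>c \<in> {..<Suc k} \<rightarrow> univ M. \<forall>i<n * m. P i (case_sum c (b i 0)) \<and> \<not> P i (case_sum c (b i 1))"
    using pat unfolding indiscernible_dp_pattern_def by (elim exE conjE) (rule that)
  obtain c where c: "c \<in> {..<Suc k} \<rightarrow> univ M"
      "\<forall>i<n * m. P i (case_sum c (b i 0)) \<and> \<not> P i (case_sum c (b i 1))"
    using Pb by blast
  have b: "b i j q \<in> univ M" for i j q
    using ind by (simp add: indiscernible_array_def)
  have row: "l * m + i < n * m" if "l < n" "i < m" for l i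
  proof -
    have "l * m + i < Suc l * m"
      using that by simp
    also have "\<dots> \<le> n * m"
      using that by (intro mult_le_mono1) simp
    finally show ?thesis .
  qed

  define enc where "enc i u q = prod_encode (i, prod_encode (u, q))" for i u q
  \<comment> \<open>The pairs chosen in the rows of block \<open>l\<close> form one tuple; \<open>\<tau> i u\<close> is the position of the entry
    number \<open>u < 2\<close> of the pair in row \<open>i\<close> of the block.\<close>
  define B where "B l \<tau> = (\<lambda>r. case prod_decode r of (i, w) \<Rightarrow> case prod_decode w of (u, q) \<Rightarrow>
      b (l * m + i mod m) (\<tau> (i mod m) (u mod 2)) q)" for l and \<tau> :: "nat \<Rightarrow> nat \<Rightarrow> nat"
  have B_enc: "B l \<tau> (enc i u q) = b (l * m + i) (\<tau> i u) q" if "i < m" "u < 2" for l \<tau> i u q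
    using that by (simp add: B_def enc_def)
  have B_univ: "B l \<tau> r \<in> univ M" for l \<tau> r
    using b by (simp add: B_def split: prod.split)
  define f :: "nat \<Rightarrow> nat \<Rightarrow> nat + nat \<Rightarrow> nat + (nat + nat)" where
    "f i u = case_sum (\<lambda>r. if r < k then Inl r else Inr (Inl 0)) (\<lambda>q. Inr (Inr (enc i u q)))" for i u
  define \<Theta> where "\<Theta> l e \<longleftrightarrow> (\<exists>c' \<in> {..<k} \<rightarrow> univ M. \<forall>i \<in> {..<m}.
      P (l * m + i) (case_sum c' e \<circ> f i 0) \<and> \<not> P (l * m + i) (case_sum c' e \<circ> f i 1))" for l e
  have f_B: "case_sum c' (case_sum (\<lambda>_. c k) (B l \<tau>)) \<circ> f i u =
      case_sum (\<lambda>r. if r < k then c' r else c k) (b (l * m + i) (\<tau> i u))"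
    if "i < m" "u < 2" for c' l \<tau> i u
    using that by (auto simp: f_def B_enc fun_eq_iff split: sum.split)

  have \<Theta>_def': "definable L M ({..<1} <+> UNIV) (\<Theta> l)" if "l < n" for l
    unfolding \<Theta>_def
  proof (rule definable_ex_left[OF univ_nonempty])
    have "definable L M ({..<k} <+> ({..<1} <+> UNIV)) (\<lambda>e. P (l * m + i) (e \<circ> f i u))"
      if "i \<in> {..<m}" for i u
      using P row[OF \<open>l < n\<close>] that
      by (intro definable_rename[of _ _ "{..<Suc k} <+> UNIV"]) (auto simp: f_def finite_Plus_UNIV_iff)
    then show "definable L M ({..<k} <+> ({..<1} <+> UNIV))
        (\<lambda>e. \<forall>i \<in> {..<m}. P (l * m + i) (e \<circ> f i 0) \<and> \<not> P (l * m + i) (e \<circ> f i 1))"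
      by (intro definable_ball definable_and definable_not) simp_all
  qed (simp add: finite_Plus_UNIV_iff)

  show ?thesis
  proof (cases "\<exists>l<n. \<forall>\<sigma> :: nat \<Rightarrow> nat. strict_mono \<sigma> \<longrightarrow>
      \<Theta> l (case_sum (\<lambda>_. c k) (B l (\<lambda>i u. 2 + \<sigma> (2 * i + u))))")
    case True
    then obtain l where l: "l < n" "\<forall>\<sigma> :: nat \<Rightarrow> nat. strict_mono \<sigma> \<longrightarrow>
        \<Theta> l (case_sum (\<lambda>_. c k) (B l (\<lambda>i u. 2 + \<sigma> (2 * i + u))))"
      by blast
    \<comment> \<open>The last coordinate of \<open>c\<close> is stored in front of the tuples of the array, as coordinate \<open>0\<close>.\<close>
    define g :: "nat + nat \<Rightarrow> nat + nat" where
      "g = case_sum (\<lambda>r. if r < k then Inl r else Inr 0) (\<lambda>q. Inr (Suc q))"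
    define b' where "b' i j = (\<lambda>q. case q of 0 \<Rightarrow> c k | Suc q \<Rightarrow> b (l * m + i) (2 + j) q)" for i j
    have g: "case_sum c' (b' i j) \<circ> g = case_sum (\<lambda>r. if r < k then c' r else c k) (b (l * m + i) (2 + j))"
      for c' i j
      by (auto simp: g_def b'_def fun_eq_iff split: sum.split)
    show ?thesis
      unfolding dp_pattern_def
    proof (intro exI[of _ "\<lambda>i e. P (l * m + i) (e \<circ> g)"] exI[of _ b'] conjI allI impI)
      show "definable L M ({..<k} <+> UNIV) (\<lambda>e. P (l * m + i) (e \<circ> g))" if "i < m" for i
        using P row[OF l(1)] that
        by (intro definable_rename[of _ _ "{..<Suc k} <+> UNIV"]) (auto simp: g_def finite_Plus_UNIV_iff)
      show "b' i j q \<in> univ M" for i j q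
        using b c(1) by (auto simp: b'_def split: nat.split)
      fix \<sigma> :: "nat \<Rightarrow> nat"
      assume "strict_mono \<sigma>"
      with l(2) have "\<Theta> l (case_sum (\<lambda>_. c k) (B l (\<lambda>i u. 2 + \<sigma> (2 * i + u))))"
        by blast
      then show "\<exists>c' \<in> {..<k} \<rightarrow> univ M. \<forall>i<m. P (l * m + i) (case_sum c' (b' i (\<sigma> (2 * i))) \<circ> g) \<and>
          \<not> P (l * m + i) (case_sum c' (b' i (\<sigma> (2 * i + 1))) \<circ> g)"
        by (auto simp: \<Theta>_def f_B g)
    qed
  next
    case False
    then have "\<forall>l \<in> {..<n}. \<exists>\<sigma> :: nat \<Rightarrow> nat. strict_mono \<sigma> \<and>
        \<not> \<Theta> l (case_sum (\<lambda>_. c k) (B l (\<lambda>i u. 2 + \<sigma> (2 * i + u))))"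
      by auto
    from bchoice[OF this] obtain \<sigma>' :: "nat \<Rightarrow> nat \<Rightarrow> nat" where \<sigma>': "\<forall>l \<in> {..<n}. strict_mono (\<sigma>' l) \<and>
        \<not> \<Theta> l (case_sum (\<lambda>_. c k) (B l (\<lambda>i u. 2 + \<sigma>' l (2 * i + u))))"
      ..
    define \<sigma> where "\<sigma> l = (if l < n then \<sigma>' l else id)" for l
    have \<sigma>: "strict_mono (\<sigma> l)" for l
      using \<sigma>' by (auto simp: \<sigma>_def strict_mono_def)
    \<comment> \<open>In each row, the original pair is followed by the pair refuting \<open>\<Theta>\<close> and by further entries.\<close>
    define \<rho> where "\<rho> l i t = (if t < 2 then t else 2 + \<sigma> l (2 * i + t - 2))" for l i t
    have \<rho>: "strict_mono (\<rho> l i)" for l i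
    proof (rule strict_monoI)
      fix t t' :: nat
      assume "t < t'"
      moreover have "\<sigma> l (2 * i + t - 2) < \<sigma> l (2 * i + t' - 2)" if "2 \<le> t"
        using \<open>t < t'\<close> that \<sigma>[of l] by (simp add: strict_mono_def)
      ultimately show "\<rho> l i t < \<rho> l i t'"
        by (auto simp: \<rho>_def)
    qed
    define b' where "b' l j = B l (\<lambda>i u. \<rho> l i (2 * j + u))" for l j
    have "indiscernible_dp_pattern 1 n"
      unfolding indiscernible_dp_pattern_def
    proof (intro exI[of _ \<Theta>] exI[of _ b'] conjI allI impI)
      show "definable L M ({..<1} <+> UNIV) (\<Theta> l)" if "l < n" for l
        using that by (rule \<Theta>_def')
      show "indiscernible_array b'"
        unfolding indiscernible_array_def
      proof (intro conjI allI impI; (elim conjE)?)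
        show "b' i j q \<in> univ M" for i j q
          by (simp add: b'_def B_univ)
        fix D :: "(nat \<times> nat \<times> nat \<Rightarrow> 'm) \<Rightarrow> bool" and s :: "nat \<Rightarrow> nat \<Rightarrow> nat"
        assume D: "definable L M UNIV D" and s: "\<forall>i. strict_mono (s i)"
        \<comment> \<open>In the original array, column \<open>t\<close> of the new one occupies the columns \<open>2 * t\<close> and \<open>2 * t + 1\<close>, before
          \<open>\<rho>\<close> is applied; \<open>S s\<close> combines \<open>\<rho>\<close> with the thinning \<open>s\<close> of the new array.\<close>
        define F :: "nat \<times> nat \<times> nat \<Rightarrow> nat \<times> nat \<times> nat" where
          "F = (\<lambda>(l, t, r). case prod_decode r of (i, w) \<Rightarrow> case prod_decode w of (u, q) \<Rightarrow>
             (l * m + i mod m, 2 * t + u mod 2, q))"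
        have "definable L M UNIV (\<lambda>e. D (e \<circ> F))"
          using D by (rule definable_rename[rotated]) (simp_all add: finite_prod)
        moreover define S where "S s i t = \<rho> (i div m) (i mod m) (2 * s (i div m) (t div 2) + t mod 2)"
          for s :: "nat \<Rightarrow> nat \<Rightarrow> nat" and i t
        have "strict_mono (S s i)" if "\<forall>i. strict_mono (s i)" for s i
        proof (rule strict_monoI)
          fix t t' :: nat
          assume "t < t'"
          have "2 * s (i div m) (t div 2) + t mod 2 < 2 * s (i div m) (t' div 2) + t' mod 2"
          proof (cases "t div 2 = t' div 2")
            case True
            then have "t mod 2 < t' mod 2"
              using \<open>t < t'\<close> mult_div_mod_eq[of 2 t] mult_div_mod_eq[of 2 t'] by linarith
            then show ?thesis
              using True by simp
          next
            case False
            then have "t div 2 < t' div 2"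
              using \<open>t < t'\<close> div_le_mono[of t t' 2] by linarith
            then have "s (i div m) (t div 2) < s (i div m) (t' div 2)"
              using that by (simp add: strict_mono_def)
            moreover have "t mod 2 < 2"
              by simp
            ultimately show ?thesis
              by linarith
          qed
          then show "S s i t < S s i t'"
            using \<rho> by (simp add: S_def strict_mono_def)
        qed
        ultimately have eq: "D ((\<lambda>(i, t, q). b i t q) \<circ> F) \<longleftrightarrow> D ((\<lambda>(i, t, q). b i (S s i t) q) \<circ> F)"
          if "\<forall>i. strict_mono (s i)" for s
          using ind[unfolded indiscernible_array_def, THEN conjunct2, rule_format, of "\<lambda>e. D (e \<circ> F)" "S s"] that
          by simp
        have "(\<lambda>(i, t, q). b i (S s i t) q) \<circ> F = (\<lambda>(l, t, r). b' l (s l t) r)" for s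
          using m by (auto simp: F_def S_def b'_def B_def fun_eq_iff split: prod.split)
        then show "D (\<lambda>(i, t, q). b' i t q) \<longleftrightarrow> D (\<lambda>(i, t, q). b' i (s i t) q)"
          using eq[OF s] eq[of "\<lambda>_ t. t"] by (simp add: strict_mono_def)
      qed
      show "\<exists>c' \<in> {..<1} \<rightarrow> univ M. \<forall>l<n. \<Theta> l (case_sum c' (b' l 0)) \<and> \<not> \<Theta> l (case_sum c' (b' l 1))"
      proof (intro bexI[of _ "\<lambda>_. c k"] allI impI conjI)
        fix l
        assume l: "l < n"
        have "P (l * m + i) (case_sum (\<lambda>r. if r < k then c r else c k) (b (l * m + i) u)) \<longleftrightarrow>
            P (l * m + i) (case_sum c (b (l * m + i) u))" if "i < m" for i u
          using P row[OF l that] b c(1) by (intro definable_agree[of L M "{..<Suc k} <+> UNIV"])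
            (auto simp: less_Suc_eq split: if_splits)
        then have "\<forall>i \<in> {..<m}. P (l * m + i) (case_sum c (case_sum (\<lambda>_. c k) (b' l 0)) \<circ> f i 0) \<and>
            \<not> P (l * m + i) (case_sum c (case_sum (\<lambda>_. c k) (b' l 0)) \<circ> f i 1)"
          using c(2) row[OF l] by (simp add: b'_def f_B \<rho>_def)
        then show "\<Theta> l (case_sum (\<lambda>_. c k) (b' l 0))"
          unfolding \<Theta>_def using c(1) by (intro bexI[of _ c]) auto
        have "b' l 1 = B l (\<lambda>i u. 2 + \<sigma>' l (2 * i + u))"
          using l by (simp add: b'_def \<rho>_def \<sigma>_def)
        then show "\<not> \<Theta> l (case_sum (\<lambda>_. c k) (b' l 1))"
          using \<sigma>' l by simp
      qed (use c(1) in auto)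
    qed
    with bound show ?thesis
      by blast
  qed
qed

text \<open>By induction, \<open>n ^ k\<close> rows are too many for \<open>k\<close> variables.\<close>

lemma dp_pattern_bounded:
  assumes "\<not> indiscernible_dp_pattern 1 n"
  shows "\<exists>N. \<not> dp_pattern k N"
proof (induction k)
  case 0
  then show ?case
    using no_dp_pattern_0 by (intro exI[of _ 1]) auto
next
  case (Suc k)
  then obtain m where m: "\<not> dp_pattern k m"
    by blast
  obtain u where "u \<in> univ M"
    using univ_nonempty by blast
  then have "dp_pattern k 0"
    unfolding dp_pattern_def by (intro exI[of _ "\<lambda>_ _. True"] exI[of _ "\<lambda>_ _ _. u"]) auto
  with m have "0 < m"
    by (cases m) auto
  then have "\<not> indiscernible_dp_pattern (Suc k) (n * m)"
    using dp_pattern_drop_variable assms m by blast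
  then show ?case
    using dp_pattern_imp_indiscernible by blast
qed

end

section \<open>Families of uniformly definable subgroups\<close>

text \<open>The product of elements that each avoid one of the subgroups \<open>H i\<close>, \<open>i \<in> S\<close>, and lie in
  all others: exactly one factor lies outside \<open>H i\<close>, and hence so does the product.\<close>

lemma separating_element:
  fixes G (structure)
  assumes G: "group G" and sub: "\<And>j. j \<in> I \<Longrightarrow> subgroup (H j) G"
    and S: "finite S" "S \<subseteq> I"
    and c: "\<And>i. i \<in> S \<Longrightarrow> \<exists>c \<in> carrier G. c \<notin> H i \<and> (\<forall>j \<in> I - {i}. c \<in> H j)"
  shows "\<exists>d \<in> carrier G. (\<forall>i \<in> S. d \<notin> H i) \<and> (\<forall>j \<in> I - S. d \<in> H j)"
  using S c
proof (induction S rule: finite_induct)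
  case empty
  interpret group G
    by (rule G)
  show ?case
    using sub by (intro bexI[of _ \<one>]) (auto intro: subgroup.one_closed)
next
  case (insert i S)
  interpret group G
    by (rule G)
  obtain d where d: "d \<in> carrier G" "\<And>i. i \<in> S \<Longrightarrow> d \<notin> H i" "\<And>j. j \<in> I - S \<Longrightarrow> d \<in> H j"
    using insert by auto
  obtain c where c: "c \<in> carrier G" "c \<notin> H i" "\<And>j. j \<in> I - {i} \<Longrightarrow> c \<in> H j"
    using insert.prems(2)[of i] by auto
  show ?case
  proof (intro bexI[of _ "d \<otimes> c"] conjI ballI)
    fix j
    assume j: "j \<in> insert i S"
    then have Hj: "subgroup (H j) G"
      using insert.prems(1) sub by blast
    show "d \<otimes> c \<notin> H j"
    proof
      assume e: "d \<otimes> c \<in> H j"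
      show False
      proof (cases "j = i")
        case True
        then have "d \<in> H j"
          using d(3) insert.prems(1) insert.hyps(2) by auto
        then have "inv d \<otimes> (d \<otimes> c) \<in> H j"
          using Hj e by (auto intro: subgroup.m_closed subgroup.m_inv_closed)
        with True c(1,2) d(1) show False
          by (simp add: m_assoc[symmetric])
      next
        case False
        then have "c \<in> H j"
          using j c(3) insert.prems(1) by auto
        then have "(d \<otimes> c) \<otimes> inv c \<in> H j"
          using Hj e by (auto intro: subgroup.m_closed subgroup.m_inv_closed)
        with False j c(1) d(1,2) show False
          by (simp add: m_assoc)
      qed
    qed
  next
    fix j
    assume "j \<in> I - insert i S"
    then show "d \<otimes> c \<in> H j"
      using sub d(3) c(3) by (auto intro: subgroup.m_closed)
  qed (use d(1) c(1) in simp)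
qed

context saturated_structure
begin

text \<open>Equality of the types over the empty set of the first \<open>n\<close> tuples.\<close>

definition same_type :: "nat \<Rightarrow> 'j set \<Rightarrow> (nat \<Rightarrow> 'j \<Rightarrow> 'm) \<Rightarrow> (nat \<Rightarrow> 'j \<Rightarrow> 'm) \<Rightarrow> bool" where
  "same_type n J \<alpha> \<beta> \<longleftrightarrow> (\<forall>D. definable L M ({..<n} \<times> J) D \<longrightarrow>
     (D (\<lambda>(t, j). \<alpha> t j) \<longleftrightarrow> D (\<lambda>(t, j). \<beta> t j)))"

lemma same_typeD:
  "\<lbrakk>same_type n J \<alpha> \<beta>; definable L M ({..<n} \<times> J) D\<rbrakk> \<Longrightarrow> D (\<lambda>(t, j). \<alpha> t j) \<longleftrightarrow> D (\<lambda>(t, j). \<beta> t j)"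
  unfolding same_type_def by blast

lemma same_type_trans:
  fixes J :: "'j set"
  assumes "same_type n J \<alpha> \<beta>" "same_type n J \<beta> \<gamma>"
  shows "same_type n J \<alpha> \<gamma>"
  unfolding same_type_def
proof (intro allI impI)
  fix D :: "(nat \<times> 'j \<Rightarrow> 'm) \<Rightarrow> bool"
  assume "definable L M ({..<n} \<times> J) D"
  from same_typeD[OF assms(1) this] same_typeD[OF assms(2) this]
  show "D (\<lambda>(t, j). \<alpha> t j) \<longleftrightarrow> D (\<lambda>(t, j). \<gamma> t j)"
    by simp
qed

lemma indiscernible_same_type:
  fixes a :: "nat \<Rightarrow> 'j \<Rightarrow> 'm" and n :: nat
  assumes a: "indiscernible_sequence L M J a"
    and s: "strict_mono_on {..<n} s" "strict_mono_on {..<n} s'"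
  shows "same_type n J (\<lambda>t. a (s t)) (\<lambda>t. a (s' t))"
  unfolding same_type_def
proof (intro allI impI)
  fix D :: "(nat \<times> 'j \<Rightarrow> 'm) \<Rightarrow> bool"
  assume D: "definable L M ({..<n} \<times> J) D"
  have "definable L M (({..<n} \<times> J) <+> ({} :: 'm set)) (\<lambda>e. D (e \<circ> Inl))"
    using D by (intro definable_rename[of _ _ "{..<n} \<times> J"]) (auto simp: finite_Plus_UNIV_iff finite_prod)
  then obtain \<phi> where \<phi>: "\<phi> \<in> formulas L (({..<n} \<times> J) <+> ({} :: 'm set))"
      "\<And>e. (\<forall>v \<in> ({..<n} \<times> J) <+> ({} :: 'm set). e v \<in> univ M) \<Longrightarrow> D (e \<circ> Inl) \<longleftrightarrow> sat M e \<phi>"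
    by (auto simp: definable_def)
  have a_univ: "a i j \<in> univ M" if "j \<in> J" for i j
    using a that by (auto simp: indiscernible_over_def tuples_def)
  have "D (\<lambda>(t, j). a (s t) j) \<longleftrightarrow> sat M (case_sum (\<lambda>(t, j). a (s t) j) id) \<phi>" for s
  proof -
    have "\<forall>v \<in> ({..<n} \<times> J) <+> ({} :: 'm set). case_sum (\<lambda>(t, j). a (s t) j) id v \<in> univ M"
      using a_univ by auto
    from \<phi>(2)[OF this] show ?thesis
      by (simp add: comp_def)
  qed
  moreover have "sat M (case_sum (\<lambda>(t, j). a (s t) j) id) \<phi> \<longleftrightarrow> sat M (case_sum (\<lambda>(t, j). a (s' t) j) id) \<phi>"
    using a \<phi>(1) s unfolding indiscernible_over_def by blast
  ultimately show "D (\<lambda>(t, j). a (s t) j) \<longleftrightarrow> D (\<lambda>(t, j). a (s' t) j)"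
    by simp
qed

text \<open>All rows of the array are the given sequence. That \<open>c\<close> can be found for any increasing
  choice of columns expresses that the existence of \<open>c\<close> is part of the type of the sequence. The
  formulas mention only a finite set \<open>F\<close> of coordinates, which \<open>g\<close> numbers.\<close>

lemma dp_pattern_from_indiscernible:
  fixes a :: "nat \<Rightarrow> 'j \<Rightarrow> 'm"
  assumes a: "indiscernible_sequence L M J a"
    and \<phi>: "\<And>i. i < N \<Longrightarrow> \<phi> i \<in> formulas L ({..<k} <+> J)"
    and c: "c \<in> {..<k} \<rightarrow> univ M"
      "\<And>i. i < N \<Longrightarrow> sat M (case_sum c (a (2 * i))) (\<phi> i) \<and> \<not> sat M (case_sum c (a (2 * i + 1))) (\<phi> i)"
  shows "dp_pattern k N"
proof -
  obtain u where u: "u \<in> univ M"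
    using univ_nonempty by blast
  have a_univ: "a i j \<in> univ M" if "j \<in> J" for i j
    using a that by (auto simp: indiscernible_over_def tuples_def)
  define F where "F = (\<Union>i \<in> {..<N}. Inr -` fv (\<phi> i))"
  have "finite F"
    unfolding F_def by (auto intro!: finite_vimageI finite_fv)
  from finite_imp_inj_to_nat_seg[OF this] obtain g :: "'j \<Rightarrow> nat" where g: "inj_on g F"
    by blast
  have F_J: "F \<subseteq> J"
    using \<phi> by (fastforce simp: F_def formulas_def)
  \<comment> \<open>The value \<open>u\<close> fills unused coordinates.\<close>
  define b where "b i t q = (if q \<in> g ` F then a t (inv_into F g q) else u)" for i t :: nat and q
  have b_univ: "b i t q \<in> univ M" for i t q
    using a_univ F_J u inv_into_into[of q g F] by (auto simp: b_def)
  define P where "P i e = sat M (e \<circ> map_sum id g) (\<phi> i)" for i e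
  have P_def': "definable L M ({..<k} <+> UNIV) (P i)" if "i < N" for i
    unfolding P_def using \<phi>[OF that]
    by (intro definable_rename[OF _ definable_sat]) (auto simp: finite_Plus_UNIV_iff)
  have P_b: "P i (case_sum d (b i t)) \<longleftrightarrow> sat M (case_sum d (a t)) (\<phi> i)" if "i < N" for i d t
    unfolding P_def
  proof (rule sat_cong)
    fix v
    assume v: "v \<in> fv (\<phi> i)"
    show "(case_sum d (b i t) \<circ> map_sum id g) v = case_sum d (a t) v"
    proof (cases v)
      case (Inr j)
      then have "j \<in> F"
        using v that by (auto simp: F_def)
      then show ?thesis
        using g Inr by (simp add: b_def)
    qed simp
  qed
  define h :: "nat \<Rightarrow> nat + 'j \<Rightarrow> nat + nat \<times> 'j" where "h t = case_sum Inl (\<lambda>j. Inr (t, j))" for t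
  have h: "case_sum d e \<circ> h t = case_sum d (\<lambda>j. e (t, j))" for d :: "nat \<Rightarrow> 'm" and e t
    by (auto simp: h_def fun_eq_iff split: sum.split)
  define D where "D e \<longleftrightarrow> (\<exists>d \<in> {..<k} \<rightarrow> univ M. \<forall>i \<in> {..<N}.
      sat M (case_sum d e \<circ> h (2 * i)) (\<phi> i) \<and> \<not> sat M (case_sum d e \<circ> h (2 * i + 1)) (\<phi> i))" for e
  have D_def': "definable L M ({..<2 * N} \<times> J) D"
    unfolding D_def
  proof (rule definable_ex_left[OF univ_nonempty])
    have "definable L M ({..<k} <+> {..<2 * N} \<times> J) (\<lambda>e. sat M (e \<circ> h t) (\<phi> i))" if "i < N" "t < 2 * N" for i t
      using \<phi>[OF that(1)] that(2)
      by (intro definable_rename[OF _ definable_sat]) (auto simp: h_def finite_Plus_UNIV_iff finite_prod)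
    then show "definable L M ({..<k} <+> {..<2 * N} \<times> J) (\<lambda>e. \<forall>i \<in> {..<N}.
        sat M (e \<circ> h (2 * i)) (\<phi> i) \<and> \<not> sat M (e \<circ> h (2 * i + 1)) (\<phi> i))"
      by (intro definable_ball definable_and definable_not) simp_all
  qed (simp add: finite_prod)
  have "D (\<lambda>(t, j). a t j)"
    unfolding D_def h using c by (intro bexI[of _ c]) auto
  then have D: "D (\<lambda>(t, j). a (\<sigma> t) j)" if "strict_mono \<sigma>" for \<sigma>
    using same_typeD[OF indiscernible_same_type[OF a, of "2 * N" id \<sigma>] D_def'] that
    by (simp add: strict_mono_on_def strict_mono_def)
  show ?thesis
    unfolding dp_pattern_def
  proof (intro exI[of _ P] exI[of _ b] conjI allI impI)
    fix \<sigma> :: "nat \<Rightarrow> nat"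
    assume "strict_mono \<sigma>"
    from D[OF this] show "\<exists>d \<in> {..<k} \<rightarrow> univ M. \<forall>i<N.
        P i (case_sum d (b i (\<sigma> (2 * i)))) \<and> \<not> P i (case_sum d (b i (\<sigma> (2 * i + 1))))"
      unfolding D_def h using P_b by auto
  qed (use P_def' b_univ in auto)
qed

lemma small_UN:
  assumes "finite I" "\<And>i. i \<in> I \<Longrightarrow> |A i| <o |univ M|"
  shows "|\<Union>i \<in> I. A i| <o |univ M|"
  using assms
proof (induction I rule: finite_induct)
  case (insert i I)
  have "|A i \<union> (\<Union>i \<in> I. A i)| <o |univ M|"
    using insert by (intro card_of_Un_ordLess_infinite infinite_univ) auto
  then show ?case
    by simp
qed (simp add: finite_small)

text \<open>An inclusion of \<open>\<Inter>l \<noteq> i. p(M, \<alpha> l)\<close> in \<open>p(M, \<alpha> i)\<close> depends only on the type of \<open>\<alpha>\<close>. It is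
  not expressed by a single formula, as \<open>p\<close> may be infinite; but if it fails for \<open>\<beta>\<close>, then it
  fails for some formula \<open>\<psi>\<close> of \<open>p\<close> on the right, and then the corresponding type over \<open>\<alpha>\<close> is
  finitely satisfiable.\<close>

lemma intersection_subset_transfer:
  fixes \<alpha> \<beta> :: "nat \<Rightarrow> 'j \<Rightarrow> 'm" and p :: "('f, 'r, nat + 'j) fm set"
  assumes J: "|J| <o |univ M|" and p: "p \<subseteq> formulas L ({..<k} <+> J)"
    and \<alpha>: "\<And>l. \<alpha> l \<in> tuples M J" and \<beta>: "\<And>l. \<beta> l \<in> tuples M J"
    and type_eq: "same_type n J \<beta> \<alpha>" and i: "i < n"
    and sub: "\<forall>c \<in> tuples M {..<k}. (\<forall>l \<in> {..<n} - {i}. c \<in> realizations M {..<k} p (\<alpha> l)) \<longrightarrow>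
      c \<in> realizations M {..<k} p (\<alpha> i)"
    and c: "c \<in> tuples M {..<k}" "\<forall>l \<in> {..<n} - {i}. c \<in> realizations M {..<k} p (\<beta> l)"
  shows "c \<in> realizations M {..<k} p (\<beta> i)"
proof (rule ccontr)
  assume "c \<notin> realizations M {..<k} p (\<beta> i)"
  then obtain \<psi> where \<psi>: "\<psi> \<in> p" "\<not> sat M (case_sum c (\<beta> i)) \<psi>"
    using c(1) by (auto simp: realizations_def)
  obtain u where u: "u \<in> univ M"
    using univ_nonempty by blast
  have univ: "\<alpha> l j \<in> univ M" "\<beta> l j \<in> univ M" if "j \<in> J" for l j
    using \<alpha>[of l] \<beta>[of l] that by (auto simp: tuples_def)
  define h :: "nat \<Rightarrow> nat + 'j \<Rightarrow> nat + nat \<times> 'j" where "h t = case_sum Inl (\<lambda>j. Inr (t, j))" for t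
  have h: "case_sum d e \<circ> h t = case_sum d (\<lambda>j. e (t, j))" for d :: "nat \<Rightarrow> 'm" and e t
    by (auto simp: h_def fun_eq_iff split: sum.split)
  define \<Gamma> where "\<Gamma> = insert (\<lambda>e. \<not> sat M (e \<circ> h i) \<psi>)
      ((\<lambda>(l, \<phi>) e. sat M (e \<circ> h l) \<phi>) ` (({..<n} - {i}) \<times> p))"
  define V where "V = {..<k} <+> {..<n} \<times> J"
  have sat_def: "definable L M V (\<lambda>e. sat M (e \<circ> h l) \<phi>)" if "l < n" "\<phi> \<in> p" for l \<phi>
    unfolding V_def using p that
    by (intro definable_rename[OF _ definable_sat[of _ _ "{..<k} <+> J"]])
      (auto simp: h_def finite_Plus_UNIV_iff finite_prod)
  have \<Gamma>_def': "definable L M V D" if "D \<in> \<Gamma>" for D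
    using that sat_def i \<psi>(1) by (auto simp: \<Gamma>_def intro!: definable_not)
  define \<alpha>' where "\<alpha>' = (\<lambda>(l, j). if l < n \<and> j \<in> J then \<alpha> l j else u)"
  have "\<exists>e. range e \<subseteq> univ M \<and> e \<circ> Inr = \<alpha>' \<and> (\<forall>D \<in> \<Gamma>. D e)"
  proof (rule compactness)
    show "range \<alpha>' \<subseteq> univ M"
      using univ u by (auto simp: \<alpha>'_def)
    have "|\<alpha> l ` J| <o |univ M|" for l
      using card_of_image J by (rule ordLeq_ordLess_trans)
    then have "|{u} \<union> (\<Union>l \<in> {..<n}. \<alpha> l ` J)| <o |univ M|"
      by (intro card_of_Un_ordLess_infinite infinite_univ small_UN) (simp_all add: finite_small)
    moreover have "range \<alpha>' \<subseteq> {u} \<union> (\<Union>l \<in> {..<n}. \<alpha> l ` J)"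
      by (fastforce simp: \<alpha>'_def)
    ultimately show "|range \<alpha>'| <o |univ M|"
      using card_of_mono1 ordLeq_ordLess_trans by blast
  next
    show "definable L M UNIV D" if "D \<in> \<Gamma>" for D
      using \<Gamma>_def'[OF that] by (rule definable_mono) simp
  next
    fix \<Delta>
    assume \<Delta>: "finite \<Delta>" "\<Delta> \<subseteq> \<Gamma>"
    define E where "E e \<longleftrightarrow> (\<exists>d \<in> {..<k} \<rightarrow> univ M. \<forall>D \<in> \<Delta>. D (case_sum d e))" for e
    have "definable L M V (\<lambda>e. \<forall>D \<in> \<Delta>. D e)"
      using \<Delta> \<Gamma>_def' by (intro definable_ball) auto
    then have "definable L M ({..<n} \<times> J) E"
      unfolding V_def E_def by (intro definable_ex_left[OF univ_nonempty]) (simp_all add: finite_prod)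
    moreover have "E (\<lambda>(t, j). \<beta> t j)"
      unfolding E_def
    proof (intro bexI[of _ c] ballI)
      fix D
      assume "D \<in> \<Delta>"
      then have "D \<in> \<Gamma>"
        using \<Delta> by blast
      then consider "D = (\<lambda>e. \<not> sat M (e \<circ> h i) \<psi>)"
        | l \<phi> where "l \<in> {..<n} - {i}" "\<phi> \<in> p" "D = (\<lambda>e. sat M (e \<circ> h l) \<phi>)"
        by (auto simp: \<Gamma>_def)
      then show "D (case_sum c (\<lambda>(t, j). \<beta> t j))"
      proof cases
        case 1
        with \<psi>(2) show ?thesis
          by (simp add: h)
      next
        case 2
        with c(2) show ?thesis
          by (simp add: h realizations_def)
      qed
    qed (use c(1) in \<open>auto simp: tuples_def\<close>)
    ultimately have "E (\<lambda>(t, j). \<alpha> t j)"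
      using same_typeD[OF type_eq, of E] by simp
    then obtain d where d: "d \<in> {..<k} \<rightarrow> univ M" "\<forall>D \<in> \<Delta>. D (case_sum d (\<lambda>(t, j). \<alpha> t j))"
      by (auto simp: E_def)
    define e where "e = case_sum (\<lambda>r. if r < k then d r else u) \<alpha>'"
    have e_univ: "e v \<in> univ M" for v
      using d(1) u univ by (auto simp: e_def \<alpha>'_def split: sum.split)
    have "D e" if "D \<in> \<Delta>" for D
    proof -
      have "D e \<longleftrightarrow> D (case_sum d (\<lambda>(t, j). \<alpha> t j))"
        using \<Delta> that e_univ by (intro definable_agree[OF \<Gamma>_def']) (auto simp: e_def V_def \<alpha>'_def)
      then show ?thesis
        using d(2)[rule_format, OF that] by (rule iffD2)
    qed
    then show "\<exists>e. range e \<subseteq> univ M \<and> e \<circ> Inr = \<alpha>' \<and> (\<forall>D \<in> \<Delta>. D e)"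
      using e_univ by (intro exI[of _ e]) (auto simp: e_def)
  qed
  then obtain e where e: "range e \<subseteq> univ M" "e \<circ> Inr = \<alpha>'" "\<forall>D \<in> \<Gamma>. D e"
    by blast
  define d where "d = restrict (e \<circ> Inl) {..<k}"
  have d: "d \<in> tuples M {..<k}"
    using e(1) by (auto simp: d_def tuples_def)
  have sat_d: "sat M (e \<circ> h l) \<phi> \<longleftrightarrow> sat M (case_sum d (\<alpha> l)) \<phi>" if "l < n" "\<phi> \<in> p" for l \<phi>
  proof (rule sat_cong)
    fix v
    assume "v \<in> fv \<phi>"
    then have "v \<in> {..<k} <+> J"
      using p that(2) by (auto simp: formulas_def)
    then show "(e \<circ> h l) v = case_sum d (\<alpha> l) v"
      using fun_cong[OF e(2), of "(l, _)"] that(1) by (auto simp: d_def h_def \<alpha>'_def)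
  qed
  have "sat M (case_sum d (\<alpha> l)) \<phi>" if "l \<in> {..<n} - {i}" "\<phi> \<in> p" for l \<phi>
    using e(3) sat_d[of l \<phi>] that by (auto simp: \<Gamma>_def)
  then have "d \<in> realizations M {..<k} p (\<alpha> i)"
    using d by (intro sub[rule_format]) (auto simp: realizations_def)
  moreover have "\<not> sat M (case_sum d (\<alpha> i)) \<psi>"
    using e(3) sat_d[OF i \<psi>(1)] by (simp add: \<Gamma>_def)
  ultimately show False
    using \<psi>(1) by (simp add: realizations_def)
qed

text \<open>If no subgroup is redundant, then for all \<open>N\<close> there is an element that lies in
  \<open>H (2 * i)\<close> but not in \<open>H (2 * i + 1)\<close>, for all \<open>i < N\<close>. As these subgroups are given by the
  same type, a formula of it distinguishes \<open>a (2 * i)\<close> from \<open>a (2 * i + 1)\<close>, which yields patterns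
  with arbitrarily many rows.\<close>

lemma redundant_subgroup:
  fixes G :: "(nat \<Rightarrow> 'm) monoid" and k :: nat and a :: "nat \<Rightarrow> 'j \<Rightarrow> 'm" and p :: "nat \<Rightarrow> ('f, 'r, nat + 'j) fm set"
  defines "H \<equiv> \<lambda>i. realizations M {..<k} (p i) (a i)"
  assumes bound: "\<not> indiscernible_dp_pattern 1 d"
    and G: "group G" and sub: "\<And>i. subgroup (H i) G" and carrier: "carrier G \<subseteq> tuples M {..<k}"
    and p: "\<And>i. p i \<subseteq> formulas L ({..<k} <+> J)" and p_eq: "\<And>i. p (2 * i) = p (2 * i + 1)"
    and a: "indiscernible_sequence L M J a"
  shows "\<exists>n. \<exists>i<n. \<forall>c \<in> carrier G. (\<forall>j \<in> {..<n} - {i}. c \<in> H j) \<longrightarrow> c \<in> H i"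
proof (rule ccontr)
  assume irredundant: "\<not> (\<exists>n. \<exists>i<n. \<forall>c \<in> carrier G. (\<forall>j \<in> {..<n} - {i}. c \<in> H j) \<longrightarrow> c \<in> H i)"
  obtain N where N: "\<not> dp_pattern k N"
    using dp_pattern_bounded[OF bound] by blast
  define S where "S = (\<lambda>i. 2 * i + 1) ` {..<N}"
  have "\<exists>c \<in> carrier G. (\<forall>i \<in> S. c \<notin> H i) \<and> (\<forall>j \<in> {..<2 * N} - S. c \<in> H j)"
  proof (rule separating_element[OF G])
    fix i
    assume "i \<in> S"
    then have "i < 2 * N"
      by (auto simp: S_def)
    with irredundant show "\<exists>c \<in> carrier G. c \<notin> H i \<and> (\<forall>j \<in> {..<2 * N} - {i}. c \<in> H j)"
      by blast
  qed (use sub in \<open>auto simp: S_def\<close>)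
  then obtain c where c: "c \<in> carrier G" "\<And>i. i \<in> S \<Longrightarrow> c \<notin> H i" "\<And>j. j \<in> {..<2 * N} - S \<Longrightarrow> c \<in> H j"
    by blast
  have c_tuple: "c \<in> tuples M {..<k}"
    using c(1) carrier by blast
  have "\<exists>\<phi> \<in> p (2 * i). sat M (case_sum c (a (2 * i))) \<phi> \<and> \<not> sat M (case_sum c (a (2 * i + 1))) \<phi>"
    if "i < N" for i
  proof -
    have "2 * i \<notin> S"
      unfolding S_def by (auto, presburger)
    then have "c \<in> H (2 * i)"
      using that by (intro c(3)) simp
    moreover have "c \<notin> H (2 * i + 1)"
      using that by (intro c(2)) (simp add: S_def)
    ultimately show ?thesis
      using c_tuple p_eq[of i] by (auto simp: H_def realizations_def)
  qed
  then obtain \<phi> where \<phi>: "\<And>i. i < N \<Longrightarrow> \<phi> i \<in> p (2 * i) \<and> sat M (case_sum c (a (2 * i))) (\<phi> i) \<and>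
      \<not> sat M (case_sum c (a (2 * i + 1))) (\<phi> i)"
    by metis
  have "dp_pattern k N"
    using \<phi> p c_tuple
    by (intro dp_pattern_from_indiscernible[OF a, of N \<phi> k c]) (auto simp: tuples_def)
  with N show False
    by blast
qed

text \<open>For a constant type, the redundancy found at the first \<open>n\<close> indices is present wherever
  their type occurs.\<close>

lemma redundant_subgroup_anywhere:
  fixes G :: "(nat \<Rightarrow> 'm) monoid" and k :: nat and a :: "nat \<Rightarrow> 'j \<Rightarrow> 'm" and p :: "('f, 'r, nat + 'j) fm set"
  defines "H \<equiv> \<lambda>i. realizations M {..<k} p (a i)"
  assumes bound: "\<not> indiscernible_dp_pattern 1 d"
    and G: "group G" and sub: "\<And>i. subgroup (H i) G" and carrier: "carrier G \<subseteq> tuples M {..<k}"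
    and p: "p \<subseteq> formulas L ({..<k} <+> J)" and J: "|J| <o |univ M|"
    and a: "indiscernible_sequence L M J a"
  shows "\<exists>n. \<exists>i<n. \<forall>\<beta>. \<forall>c \<in> tuples M {..<k}. (\<forall>l. \<beta> l \<in> tuples M J) \<and> same_type n J \<beta> a \<and>
    (\<forall>l \<in> {..<n} - {i}. c \<in> realizations M {..<k} p (\<beta> l)) \<longrightarrow> c \<in> realizations M {..<k} p (\<beta> i)"
proof -
  have "\<exists>n. \<exists>i<n. \<forall>c \<in> carrier G. (\<forall>j \<in> {..<n} - {i}. c \<in> H j) \<longrightarrow> c \<in> H i"
    unfolding H_def by (rule redundant_subgroup[OF bound G _ carrier p _ a]) (use sub in \<open>auto simp: H_def\<close>)
  then obtain n0 i where i: "i < n0"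
      "\<forall>c \<in> carrier G. (\<forall>j \<in> {..<n0} - {i}. c \<in> H j) \<longrightarrow> c \<in> H i"
    by blast
  \<comment> \<open>The index set is enlarged so that some other subgroup remains: being in it forces
    membership in the group, whose own parameters need not be indiscernible with the sequence.\<close>
  define n where "n = Suc n0"
  define i' where "i' = (if i = 0 then 1 else 0 :: nat)"
  have i': "i' \<in> {..<n} - {i}"
    using i(1) by (auto simp: n_def i'_def)
  have i_n: "i < n"
    using i(1) by (simp add: n_def)
  have *: "\<forall>c \<in> tuples M {..<k}. (\<forall>l \<in> {..<n} - {i}. c \<in> realizations M {..<k} p (a l)) \<longrightarrow>
      c \<in> realizations M {..<k} p (a i)"
  proof (intro ballI impI)
    fix e
    assume e: "\<forall>l \<in> {..<n} - {i}. e \<in> realizations M {..<k} p (a l)"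
    then have "e \<in> H i'"
      using i' by (simp add: H_def)
    then have "e \<in> carrier G"
      using subgroup.subset[OF sub] by blast
    with i(2) e show "e \<in> realizations M {..<k} p (a i)"
      by (auto simp: H_def n_def)
  qed
  have a_tuple: "a l \<in> tuples M J" for l
    using a by (simp add: indiscernible_over_def)
  show ?thesis
    using intersection_subset_transfer[where \<alpha> = a and n = n and i = i, OF J p a_tuple _ _ i_n *]
    by (intro exI[of _ n] exI[of _ i]) (simp add: i_n)
qed

end

lemma monster_model_saturated: "monster_model L T M \<Longrightarrow> saturated_structure L M"
  using ordLess_imp_ordLeq infinite_iff_natLeq_ordLeq
  unfolding monster_model_def saturated_structure_def by blast

lemma (in saturated_structure) bounded_dp_rank_pattern:
  assumes "bounded_dp_rank L M"
  obtains d where "\<not> indiscernible_dp_pattern 1 d"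
  using assms not_indiscernible_dp_pattern unfolding bounded_dp_rank_def by metis

lemma type_definable_group_tuples:
  "type_definable_group L M k G \<Longrightarrow> group G \<and> carrier G \<subseteq> tuples M {..<k}"
  by (auto simp: type_definable_group_def realizations_def)

text \<open>Every increasing \<open>n\<close>-tuple of indices has a redundant entry, so a set of more than \<open>n\<close>
  indices can be thinned out one by one.\<close>

lemma (in saturated_structure) property_A_if_bounded_dp_rank:
  assumes "bounded_dp_rank L M"
  shows "property_A TYPE('j) L M"
  unfolding property_A_def
proof (intro allI impI; elim conjE)
  fix k G p and J :: "'j set" and a :: "nat \<Rightarrow> 'j \<Rightarrow> 'm"
  assume G: "type_definable_group L M k G" and J: "|J| <o |univ M|"
    and p: "p \<subseteq> formulas L ({..<k} <+> J)" and a: "indiscernible_sequence L M J a"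
    and sub: "\<forall>i. subgroup (realizations M {..<k} p (a i)) G"
  let ?H = "\<lambda>i. realizations M {..<k} p (a i)"
  obtain d where d: "\<not> indiscernible_dp_pattern 1 d"
    using assms by (rule bounded_dp_rank_pattern)
  have grp: "group G" "carrier G \<subseteq> tuples M {..<k}"
    using type_definable_group_tuples[OF G] by auto
  obtain n i where i: "i < n" and red: "\<forall>\<beta>. \<forall>c \<in> tuples M {..<k}. (\<forall>l. \<beta> l \<in> tuples M J) \<and>
      same_type n J \<beta> a \<and> (\<forall>l \<in> {..<n} - {i}. c \<in> realizations M {..<k} p (\<beta> l)) \<longrightarrow>
      c \<in> realizations M {..<k} p (\<beta> i)"
    using redundant_subgroup_anywhere[OF d grp(1) spec[OF sub] grp(2) p J a] by blast
  have red_mono: "c \<in> ?H (s i)"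
    if s: "strict_mono_on {..<n} s" and c: "c \<in> carrier G" "\<forall>l \<in> {..<n} - {i}. c \<in> ?H (s l)" for s c
  proof -
    have "same_type n J (\<lambda>t. a (s t)) a"
      using indiscernible_same_type[OF a s, of "\<lambda>t. t"] by (simp add: strict_mono_on_def)
    then show ?thesis
      using c grp(2) a by (intro red[rule_format, of c "\<lambda>l. a (s l)"]) (auto simp: indiscernible_over_def)
  qed
  have "\<exists>v' \<subseteq> v. card v' \<le> n \<and> inter_in G v ?H = inter_in G v' ?H" if "finite v" for v
    using that
  proof (induction v rule: finite_psubset_induct)
    case (psubset v)
    show ?case
    proof (cases "card v \<le> n")
      case False
      define s where "s l = sorted_list_of_set v ! l" for l
      have len: "length (sorted_list_of_set v) = card v"
        by simp
      have s: "strict_mono_on {..<n} s"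
        using False sorted_list_of_set.strict_sorted_key_list_of_set[of v] len
        by (auto simp: s_def strict_mono_on_def sorted_wrt_iff_nth_less)
      have s_v: "s l \<in> v" if "l < n" for l
        using that False len nth_mem[of l "sorted_list_of_set v"] psubset.hyps by (simp add: s_def)
      have s_inj: "s l \<noteq> s i" if "l \<in> {..<n} - {i}" for l
        using strict_mono_on_imp_inj_on[OF s] that i by (auto simp: inj_on_def)
      have "inter_in G v ?H = inter_in G (v - {s i}) ?H"
      proof (intro equalityI subsetI)
        fix c
        assume c: "c \<in> inter_in G (v - {s i}) ?H"
        then have "c \<in> ?H (s i)"
          using s_v s_inj by (intro red_mono[OF s]) (auto simp: inter_in_def)
        with c show "c \<in> inter_in G v ?H"
          by (auto simp: inter_in_def)
      qed (auto simp: inter_in_def)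
      moreover have "v - {s i} \<subset> v"
        using s_v[OF i] by blast
      ultimately show ?thesis
        using psubset.IH[of "v - {s i}"] by blast
    qed auto
  qed
  then show "\<exists>n. \<forall>v. finite v \<longrightarrow> (\<exists>v' \<subseteq> v. card v' \<le> n \<and> inter_in G v ?H = inter_in G v' ?H)"
    by blast
qed

text \<open>In an indiscernible set, the order in which the indices are listed does not matter. Hence
  the redundant entry can be made the last one: the intersection of the first \<open>n - 1\<close> subgroups is
  contained in every later one.\<close>

lemma (in saturated_structure) indiscernible_set_intersection:
  fixes a :: "nat \<Rightarrow> 'j \<Rightarrow> 'm"
  assumes "bounded_dp_rank L M" and G: "type_definable_group L M k G" and J: "|J| <o |univ M|"
    and p: "p \<subseteq> formulas L ({..<k} <+> J)" and a: "indiscernible_set L M J a"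
    and sub: "\<forall>i. subgroup (realizations M {..<k} p (a i)) G"
  shows "\<exists>n. inter_in G UNIV (\<lambda>i. realizations M {..<k} p (a i)) =
    inter_in G {..<n} (\<lambda>i. realizations M {..<k} p (a i))"
proof -
  let ?H = "\<lambda>i. realizations M {..<k} p (a i)"
  obtain d where d: "\<not> indiscernible_dp_pattern 1 d"
    using assms(1) by (rule bounded_dp_rank_pattern)
  have grp: "group G" "carrier G \<subseteq> tuples M {..<k}"
    using type_definable_group_tuples[OF G] by auto
  have seq: "indiscernible_sequence L M J (a \<circ> \<pi>)" if "bij \<pi>" for \<pi>
    using a that by (simp add: indiscernible_set_def)
  have seq_a: "indiscernible_sequence L M J a"
    using seq[of id] by simp
  obtain n i where i: "i < n" and red: "\<forall>\<beta>. \<forall>c \<in> tuples M {..<k}. (\<forall>l. \<beta> l \<in> tuples M J) \<and>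
      same_type n J \<beta> a \<and> (\<forall>l \<in> {..<n} - {i}. c \<in> realizations M {..<k} p (\<beta> l)) \<longrightarrow>
      c \<in> realizations M {..<k} p (\<beta> i)"
    using redundant_subgroup_anywhere[OF d grp(1) spec[OF sub] grp(2) p J seq_a] by blast
  have "c \<in> ?H x" if x: "n - 1 \<le> x" and c: "c \<in> carrier G" "\<And>l. l < n - 1 \<Longrightarrow> c \<in> ?H l" for x c
  proof -
    define s where "s l = (if l = n - 1 then x else l)" for l
    \<comment> \<open>Listed in increasing order, the redundant entry among \<open>0, \<dots>, n - 2, x\<close> is \<open>s i\<close>; it is exchanged with \<open>x\<close>.\<close>
    define \<pi> where "\<pi> y = (if y = s i then x else if y = x then s i else y)" for y
    have "\<pi> \<circ> \<pi> = id"
      by (auto simp: \<pi>_def fun_eq_iff)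
    then have bij: "bij \<pi>"
      by (rule o_bij) fact
    have s: "strict_mono_on {..<n} s"
      using x by (auto simp: s_def strict_mono_on_def)
    have \<pi>_i: "\<pi> (s i) = x"
      by (simp add: \<pi>_def)
    have "\<pi> (s l) < n - 1" if "l \<in> {..<n} - {i}" for l
      using that x i by (auto simp: \<pi>_def s_def)
    then have "c \<in> ?H (\<pi> (s l))" if "l \<in> {..<n} - {i}" for l
      using that c(2) by blast
    moreover have "same_type n J (\<lambda>t. a (\<pi> (s t))) a"
    proof -
      \<comment> \<open>Far out, the permutation is the identity, so both sequences have the same type there.\<close>
      define r where "r t = Suc (n + x + t)" for t
      have r: "strict_mono_on {..<n} r" "\<And>t. \<pi> (r t) = r t"
        using x i by (auto simp: r_def strict_mono_on_def \<pi>_def s_def)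
      have "same_type n J (\<lambda>t. a (\<pi> (s t))) (\<lambda>t. a (r t))"
        using indiscernible_same_type[OF seq[OF bij] s r(1)] by (simp add: r(2))
      moreover have "same_type n J (\<lambda>t. a (r t)) a"
        using indiscernible_same_type[OF seq_a r(1), of "\<lambda>t. t"] by (simp add: strict_mono_on_def)
      ultimately show ?thesis
        by (rule same_type_trans)
    qed
    ultimately have "c \<in> realizations M {..<k} p (a (\<pi> (s i)))"
      using c(1) grp(2) seq_a
      by (intro red[rule_format, of c "\<lambda>l. a (\<pi> (s l))"]) (auto simp: indiscernible_over_def)
    then show ?thesis
      by (simp add: \<pi>_i)
  qed
  then have "c \<in> inter_in G UNIV ?H" if "c \<in> inter_in G {..<n - 1} ?H" for c
    using that unfolding inter_in_def by (auto, metis lessThan_iff not_less)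
  then have "inter_in G UNIV ?H = inter_in G {..<n - 1} ?H"
    by (auto simp: inter_in_def)
  then show ?thesis
    by blast
qed

theorem lemma3p10:
  fixes L :: "('f, 'r) language"
    and T :: "('f, 'r, nat) fm set"
    and \<CC> :: "('f, 'r, 'm) struct"
  assumes "complete_theory L T"
    and "monster_model L T \<CC>"
    and "bounded_dp_rank L \<CC>"
  shows
    "(\<forall>k G (J :: 'j set) p a.
        type_definable_group L \<CC> k G \<and> |J| <o |univ \<CC>| \<and>
        (\<forall>i. p i \<subseteq> formulas L ({..<k} <+> J)) \<and>
        (\<forall>i. subgroup (realizations \<CC> {..<k} (p i) (a i)) G) \<and>
        indiscernible_sequence L \<CC> J a \<and>
        (\<forall>i. p (2 * i) = p (2 * i + 1)) \<longrightarrow>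
        (\<exists>n. \<exists>i<n.
           inter_in G ({..<n} - {i}) (\<lambda>j. realizations \<CC> {..<k} (p j) (a j)) =
           inter_in G {..<n} (\<lambda>j. realizations \<CC> {..<k} (p j) (a j)))) \<and>
     (\<forall>k G (J :: 'j set) p a.
        type_definable_group L \<CC> k G \<and> |J| <o |univ \<CC>| \<and>
        p \<subseteq> formulas L ({..<k} <+> J) \<and>
        (\<forall>i. subgroup (realizations \<CC> {..<k} p (a i)) G) \<and>
        indiscernible_set L \<CC> J a \<longrightarrow>
        (\<exists>n. inter_in G UNIV (\<lambda>i. realizations \<CC> {..<k} p (a i)) =
             inter_in G {..<n} (\<lambda>i. realizations \<CC> {..<k} p (a i)))) \<and>
     property_A TYPE('j) L \<CC>"
proof -
  interpret saturated_structure L \<CC>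
    using assms(2) by (rule monster_model_saturated)
  obtain d where d: "\<not> indiscernible_dp_pattern 1 d"
    using assms(3) by (rule bounded_dp_rank_pattern)
  have irr: "\<exists>n. \<exists>i<n. inter_in G ({..<n} - {i}) (\<lambda>j. realizations \<CC> {..<k} (p j) (a j)) =
      inter_in G {..<n} (\<lambda>j. realizations \<CC> {..<k} (p j) (a j))"
    if G: "type_definable_group L \<CC> k G" and p: "\<forall>i. p i \<subseteq> formulas L ({..<k} <+> J)"
      and sub: "\<forall>i. subgroup (realizations \<CC> {..<k} (p i) (a i)) G"
      and a: "indiscernible_sequence L \<CC> J a" and p_eq: "\<forall>i. p (2 * i) = p (2 * i + 1)"
    for k G and J :: "'j set" and p a
  proof -
    let ?H = "\<lambda>j. realizations \<CC> {..<k} (p j) (a j)"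
    obtain n i where "i < n" "\<forall>c \<in> carrier G. (\<forall>j \<in> {..<n} - {i}. c \<in> ?H j) \<longrightarrow> c \<in> ?H i"
      using redundant_subgroup[of d G k p a J] type_definable_group_tuples[OF G] d p sub a p_eq by blast
    then show ?thesis
      by (intro exI[of _ n] exI[of _ i]) (auto simp: inter_in_def)
  qed
  have stab: "\<exists>n. inter_in G UNIV (\<lambda>i. realizations \<CC> {..<k} p (a i)) =
      inter_in G {..<n} (\<lambda>i. realizations \<CC> {..<k} p (a i))"
    if "type_definable_group L \<CC> k G" "|J| <o |univ \<CC>|" "p \<subseteq> formulas L ({..<k} <+> J)"
      "\<forall>i. subgroup (realizations \<CC> {..<k} p (a i)) G" "indiscernible_set L \<CC> J a"
    for k G and J :: "'j set" and p a
    using that by (intro indiscernible_set_intersection[OF assms(3)])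
  show ?thesis
    by ((intro conjI allI impI property_A_if_bounded_dp_rank[OF assms(3)]; elim conjE),
      (rule irr; assumption), (rule stab; assumption))
qed

end
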